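(* Let $f\in\mathcal{S}$ be given by $f(z)=z+\sum_{n=2}^{\infty}a_nz^n$ for $|z|<1$, and suppose that $a_3=0$. Then (i) $|a_2|\le 1$; (ii) $|a_4|\le \frac{\sqrt{37}+13}{12}=1.59023\ldots$; (iii) $|a_5|\le \frac14\sqrt{\frac{757}{15}}+\frac{85}{64}=3.10412\ldots$; (iv) $|H_2(2)|\le \frac{13+\sqrt{37}}{12}=1.59023\ldots$; (v) $|H_3(1)|\le \frac{24+\sqrt{645}}{30}=1.64656\ldots$.
   Context: Let $\mathbb{D}=\{z\in\mathbb{C}:|z|<1\}$. $\mathcal{S}$ denotes the class of functions $f$ that are analytic and univalent (injective) in $\mathbb{D}$, with power series expansion $f(z)=z+a_2z^2+a_3z^3+\cdots$ (so $f(0)=0$, $f'(0)=1$). For such $f$ the second and third Hankel determinants are $$H_2(2)=a_2a_4-a_3^2,\qquad H_3(1)=a_3(a_2a_4-a_3^2)-a_4(a_4-a_2a_3)+a_5(a_3-a_2^2).$$ *)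

theory Defs
  imports "HOL-Complex_Analysis.Complex_Analysis"
begin

definition class_S :: "(complex \<Rightarrow> complex) set" where
  "class_S = {f. f analytic_on ball 0 1 \<and> inj_on f (ball 0 1) \<and> f 0 = 0 \<and> deriv f 0 = 1}"

(* Hankel determinants of the coefficient sequence of a function in class_S;
   the normalisation a 1 = 1 is already substituted in the expansion of H_3(1). *)

definition hankel_2_2 :: "(nat \<Rightarrow> complex) \<Rightarrow> complex" where
  "hankel_2_2 a = a 2 * a 4 - (a 3)\<^sup>2"

definition hankel_3_1 :: "(nat \<Rightarrow> complex) \<Rightarrow> complex" where
  "hankel_3_1 a =
     a 3 * (a 2 * a 4 - (a 3)\<^sup>2) - a 4 * (a 4 - a 2 * a 3) + a 5 * (a 3 - (a 2)\<^sup>2)"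

end

theory Submission
  imports Defs "HOL-Computational_Algebra.Fundamental_Theorem_Algebra" "HOL-Real_Asymp.Real_Asymp"
begin

text \<open>
  Everything rests on one inequality of area type. Let \<open>F\<close> be univalent in the unit disc with \<open>F 0 = 0\<close>, let
  \<open>P\<close> be a polynomial, and let \<open>P (1 / F z) = \<Sum> g\<^sub>k z ^ (k - n)\<close>. Then
  \<open>\<Sum> (k - n) \<bar>g\<^sub>k\<bar>\<^sup>2 \<le> 0\<close> (lemma \<open>area_theorem_polynomial\<close>). The sum is, up to the factor \<open>\<pi>\<close>, the
  signed area enclosed by the image of a circle under \<open>P (1 / F)\<close>, in the limit where the circle tends to the
  unit circle. This area is the integral of the winding number over the plane
  (\<open>closed_curve_area_nonpos\<close>), and the winding number is nowhere positive: \<open>P (1 / F) - w\<close> is a constant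
  times a product of factors \<open>1 / F - u\<close>, each of which has one pole and, by univalence, at most one zero
  (\<open>has_contour_integral_log_deriv_poly_inverse\<close>).

  Write \<open>f = z + a\<^sub>2 z\<^sup>2 + a\<^sub>4 z ^ 4 + \<dots>\<close>, with \<open>a\<^sub>3 = 0\<close>. For \<open>F = f\<close> and \<open>P = X\<close> the inequality yields
  \<open>\<bar>a\<^sub>2\<^sup>2 - a\<^sub>3\<bar> \<le> 1\<close>, hence \<open>\<bar>a\<^sub>2\<bar> \<le> 1\<close>. The other coefficients are reached through
  the odd univalent function \<open>F z = sqrt (f (z\<^sup>2))\<close> and \<open>P = X ^ 3 + 3/2 a\<^sub>2 X\<close>, which is the third Faber
  polynomial of \<open>1 / F\<close>. The inequality then reads
  \<open>81/64 \<bar>a\<^sub>2\<bar> ^ 4 + 3 \<bar>D\<bar>\<^sup>2 + 5 \<bar>E\<bar>\<^sup>2 \<le> 3\<close> with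
  \<open>D = 3/2 a\<^sub>4 + 13/8 a\<^sub>2 ^ 3\<close> and \<open>E = 3/2 a\<^sub>5 - 3 a\<^sub>2 a\<^sub>4 - 255/128 a\<^sub>2 ^ 4\<close>. Dropping \<open>E\<close> and maximising
  over \<open>\<bar>a\<^sub>2\<bar> \<le> 1\<close> gives the bound for \<open>a\<^sub>4\<close>, the maximum being at \<open>\<bar>a\<^sub>2\<bar> = 1\<close>. The second
  Hankel determinant is \<open>a\<^sub>2 a\<^sub>4\<close>, so it obeys the same bound. For \<open>a\<^sub>5\<close> and the third
  determinant \<open>- (a\<^sub>4\<^sup>2 + a\<^sub>5 a\<^sub>2\<^sup>2)\<close> there is room to spare: both are expressed in \<open>a\<^sub>2\<close>, \<open>D\<close> and \<open>E\<close>, and bounding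
  these three separately already yields \<open>27/10\<close> and \<open>71/50\<close>.
\<close>

section \<open>Integrability of the winding kernel\<close>

lemma nn_integral_inverse_sqrt_abs_le:
  fixes x A :: real
  assumes "\<bar>x\<bar> \<le> A"
  shows "(\<integral>\<^sup>+\<xi>. ennreal (indicator {-A..A} \<xi> / sqrt \<bar>x - \<xi>\<bar>) \<partial>lborel) \<le> ennreal (4 * sqrt (2 * A))"
proof -
  define F where "F = (\<lambda>\<xi>. 2 * sgn (\<xi> - x) * sqrt \<bar>\<xi> - x\<bar>)"
  have F_alt: "F \<xi> = 2 * sqrt (max 0 (\<xi> - x)) - 2 * sqrt (max 0 (x - \<xi>))" for \<xi>
    by (auto simp: F_def sgn_if max_def)
  have "((\<lambda>\<xi>. 1 / sqrt \<bar>x - \<xi>\<bar>) has_integral (F A - F (-A))) {-A..A}"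
  proof (rule fundamental_theorem_of_calculus_interior_strong[where S = "{x}"])
    show "continuous_on {-A..A} F"
      unfolding F_alt by (intro continuous_intros)
    fix \<xi> assume "\<xi> \<in> {-A<..<A} - {x}"
    then consider "\<xi> > x" | "\<xi> < x" by fastforce
    then have "(F has_real_derivative 1 / sqrt \<bar>x - \<xi>\<bar>) (at \<xi>)"
    proof cases
      case 1
      have "((\<lambda>\<xi>. 2 * sqrt (\<xi> - x)) has_real_derivative 1 / sqrt \<bar>x - \<xi>\<bar>) (at \<xi>)"
        using 1 by (auto intro!: derivative_eq_intros simp: field_simps)
      then show ?thesis
        by (rule has_field_derivative_transform_within_open[where S = "{x<..}"])
           (use 1 in \<open>auto simp: F_def\<close>)
    next
      case 2
      have "((\<lambda>\<xi>. - (2 * sqrt (x - \<xi>))) has_real_derivative 1 / sqrt \<bar>x - \<xi>\<bar>) (at \<xi>)"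
        using 2 by (auto intro!: derivative_eq_intros simp: field_simps)
      then show ?thesis
        by (rule has_field_derivative_transform_within_open[where S = "{..<x}"])
           (use 2 in \<open>auto simp: F_def\<close>)
    qed
    then show "(F has_vector_derivative 1 / sqrt \<bar>x - \<xi>\<bar>) (at \<xi>)"
      by (simp add: has_real_derivative_iff_has_vector_derivative)
  qed (use assms in auto)
  then have "((\<lambda>\<xi>. indicator {-A..A} \<xi> / sqrt \<bar>x - \<xi>\<bar>) has_integral (F A - F (-A))) UNIV"
    by (subst (asm) has_integral_restrict_UNIV[symmetric])
       (auto simp: indicator_def if_distrib cong: if_cong elim!: has_integral_eq[rotated])
  then have "(\<integral>\<^sup>+\<xi>. ennreal (indicator {-A..A} \<xi> / sqrt \<bar>x - \<xi>\<bar>) \<partial>lborel) = ennreal (F A - F (-A))"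
    by (intro nn_integral_has_integral_lborel) auto
  also have "\<dots> \<le> ennreal (4 * sqrt (2 * A))"
  proof (intro ennreal_leI)
    have "sqrt \<bar>A - x\<bar> \<le> sqrt (2 * A)" "sqrt \<bar>-A - x\<bar> \<le> sqrt (2 * A)"
      using assms by (auto intro!: real_sqrt_le_mono)
    moreover have "F A \<le> 2 * sqrt \<bar>A - x\<bar>" "- F (-A) \<le> 2 * sqrt \<bar>-A - x\<bar>"
      by (auto simp: F_def sgn_if)
    ultimately show "F A - F (-A) \<le> 4 * sqrt (2 * A)" by linarith
  qed
  finally show ?thesis .
qed

text \<open>
  This splits the planar singularity \<open>1 / \<bar>z\<bar>\<close> into a product of two integrable singularities on the
  line, so that its integral over a rectangle can be estimated by Tonelli without polar coordinates.
\<close>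
lemma norm_complex_ge_sqrt_mult:
  "sqrt \<bar>Re z\<bar> * sqrt \<bar>Im z\<bar> \<le> norm z"
proof -
  have "\<bar>Re z\<bar> * \<bar>Im z\<bar> \<le> norm z * norm z"
    by (intro mult_mono abs_Re_le_cmod abs_Im_le_cmod) auto
  then have "sqrt (\<bar>Re z\<bar> * \<bar>Im z\<bar>) \<le> sqrt (norm z * norm z)"
    by (rule real_sqrt_le_mono)
  then show ?thesis by (simp add: real_sqrt_mult)
qed

lemma borel_measurable_Complex [measurable (raw)]:
  assumes "f \<in> borel_measurable M" "g \<in> borel_measurable M"
  shows "(\<lambda>x. Complex (f x) (g x)) \<in> borel_measurable M"
  using assms unfolding Complex_eq by measurable

text \<open>
  For a closed curve, the imaginary part of \<open>p' / (p - \<zeta>)\<close> integrated over \<open>t\<close> is \<open>2 \<pi>\<close> times the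
  winding number of \<open>p\<close> about \<open>\<zeta>\<close>. It is singular wherever \<open>\<zeta>\<close> lies on the curve, and joint integrability in \<open>t\<close> and
  \<open>\<zeta> = \<xi> + i \<eta>\<close> is what allows the order of integration to be exchanged. The integral over
  \<open>\<xi>\<close> is innermost because it is the one that is evaluated in closed form.
\<close>
lemma winding_kernel_integrable:
  fixes p p' :: "real \<Rightarrow> complex"
  assumes cont: "continuous_on UNIV p" "continuous_on UNIV p'"
    and B: "\<And>t. t \<in> {0..1} \<Longrightarrow> norm (p t) \<le> B" and "B \<le> A"
  shows "integrable (lborel \<Otimes>\<^sub>M (lborel \<Otimes>\<^sub>M lborel))
    (\<lambda>(t, \<eta>, \<xi>). indicator {0..1} t * (indicator {-B..B} \<eta> * (indicator {-A..A} \<xi> *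
        Im (p' t / (p t - Complex \<xi> \<eta>)))))" (is "integrable _ ?f")
proof (rule integrableI_bounded)
  have [measurable]: "p \<in> borel_measurable borel" "p' \<in> borel_measurable borel"
    using cont by (auto intro: borel_measurable_continuous_onI)
  show meas: "?f \<in> borel_measurable (lborel \<Otimes>\<^sub>M (lborel \<Otimes>\<^sub>M lborel))"
    unfolding case_prod_beta by measurable
  have "bounded (p' ` {0..1})"
    by (intro compact_imp_bounded compact_continuous_image continuous_on_subset[OF cont(2)]) auto
  then obtain C where "\<forall>v \<in> p' ` {0..1}. norm v \<le> C"
    unfolding bounded_iff by blast
  then have C: "norm (p' t) \<le> C" if "t \<in> {0..1}" for t
    using that by blast
  have "0 \<le> C" by (rule order_trans[OF norm_ge_zero C[of 0]]) simp
  have "0 \<le> B" by (rule order_trans[OF norm_ge_zero B[of 0]]) simp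
  define K where "K = 4 * sqrt (2 * A)"
  define L where "L = 4 * sqrt (2 * B)"
  have inner: "(\<integral>\<^sup>+\<xi>. norm (?f (t, \<eta>, \<xi>)) \<partial>lborel)
      \<le> ennreal (C * K) * ennreal (indicator {-B..B} \<eta> / sqrt \<bar>Im (p t) - \<eta>\<bar>)"
    if t: "t \<in> {0..1}" and \<eta>: "\<eta> \<noteq> Im (p t)" for t \<eta>
  proof -
    define b where "b = indicator {-B..B} \<eta> / sqrt \<bar>Im (p t) - \<eta>\<bar>"
    have "0 \<le> b" by (auto simp: b_def)
    have "\<bar>Re (p t)\<bar> \<le> A" using B[OF t] \<open>B \<le> A\<close> abs_Re_le_cmod[of "p t"] by linarith
    have "AE \<xi> in lborel. \<xi> \<noteq> Re (p t)" by (rule AE_lborel_singleton)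
    then have "(\<integral>\<^sup>+\<xi>. norm (?f (t, \<eta>, \<xi>)) \<partial>lborel)
        \<le> (\<integral>\<^sup>+\<xi>. ennreal (C * b) * ennreal (indicator {-A..A} \<xi> / sqrt \<bar>Re (p t) - \<xi>\<bar>) \<partial>lborel)"
    proof (intro nn_integral_mono_AE, eventually_elim)
      fix \<xi> assume \<xi>: "\<xi> \<noteq> Re (p t)"
      define z where "z = p t - Complex \<xi> \<eta>"
      have "Re z = Re (p t) - \<xi>" "Im z = Im (p t) - \<eta>" by (auto simp: z_def)
      have pos: "sqrt \<bar>Re z\<bar> * sqrt \<bar>Im z\<bar> > 0"
        using \<xi> \<eta> by (auto simp: z_def)
      have "\<bar>Im (p' t / z)\<bar> \<le> norm (p' t) / norm z"
        using abs_Im_le_cmod[of "p' t / z"] by (simp add: norm_divide)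
      also have "\<dots> \<le> C / (sqrt \<bar>Re z\<bar> * sqrt \<bar>Im z\<bar>)"
        using pos norm_complex_ge_sqrt_mult[of z] C[OF t] \<open>0 \<le> C\<close> by (intro frac_le) auto
      finally have *: "\<bar>Im (p' t / z)\<bar> \<le> C / (sqrt \<bar>Re z\<bar> * sqrt \<bar>Im z\<bar>)" .
      show "ennreal (norm (?f (t, \<eta>, \<xi>)))
        \<le> ennreal (C * b) * ennreal (indicator {-A..A} \<xi> / sqrt \<bar>Re (p t) - \<xi>\<bar>)"
        using t * \<open>0 \<le> C\<close> \<open>0 \<le> b\<close> unfolding z_def[symmetric] b_def
        by (subst ennreal_mult[symmetric]) (auto simp: z_def indicator_def abs_mult mult_ac intro!: ennreal_leI)
    qed
    also have "\<dots> = ennreal (C * b) * (\<integral>\<^sup>+\<xi>. ennreal (indicator {-A..A} \<xi> / sqrt \<bar>Re (p t) - \<xi>\<bar>) \<partial>lborel)"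
      by (intro nn_integral_cmult) auto
    also have "\<dots> \<le> ennreal (C * b) * ennreal K"
      unfolding K_def using \<open>\<bar>Re (p t)\<bar> \<le> A\<close> by (intro mult_left_mono nn_integral_inverse_sqrt_abs_le) auto
    also have "\<dots> = ennreal (C * K) * ennreal b"
      using \<open>0 \<le> C\<close> \<open>0 \<le> b\<close> \<open>0 \<le> B\<close> \<open>B \<le> A\<close> by (simp add: K_def ennreal_mult[symmetric] mult_ac)
    finally show ?thesis by (simp add: b_def)
  qed
  have mid: "(\<integral>\<^sup>+\<eta>. \<integral>\<^sup>+\<xi>. norm (?f (t, \<eta>, \<xi>)) \<partial>lborel \<partial>lborel)
      \<le> ennreal (C * K) * ennreal L * indicator {0..1} t" for t
  proof (cases "t \<in> {0..1}")
    case True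
    have Im: "\<bar>Im (p t)\<bar> \<le> B" using B[OF True] abs_Im_le_cmod[of "p t"] by linarith
    have "AE \<eta> in lborel. \<eta> \<noteq> Im (p t)" by (rule AE_lborel_singleton)
    then have "(\<integral>\<^sup>+\<eta>. \<integral>\<^sup>+\<xi>. norm (?f (t, \<eta>, \<xi>)) \<partial>lborel \<partial>lborel)
        \<le> (\<integral>\<^sup>+\<eta>. ennreal (C * K) * ennreal (indicator {-B..B} \<eta> / sqrt \<bar>Im (p t) - \<eta>\<bar>) \<partial>lborel)"
      by (intro nn_integral_mono_AE, eventually_elim) (rule inner[OF True])
    also have "\<dots> = ennreal (C * K) * (\<integral>\<^sup>+\<eta>. ennreal (indicator {-B..B} \<eta> / sqrt \<bar>Im (p t) - \<eta>\<bar>) \<partial>lborel)"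
      by (intro nn_integral_cmult) auto
    also have "\<dots> \<le> ennreal (C * K) * ennreal L"
      unfolding L_def using Im by (intro mult_left_mono nn_integral_inverse_sqrt_abs_le) auto
    finally show ?thesis using True by simp
  qed auto
  have "(\<integral>\<^sup>+z. norm (?f z) \<partial>(lborel \<Otimes>\<^sub>M (lborel \<Otimes>\<^sub>M lborel)))
      = (\<integral>\<^sup>+t. \<integral>\<^sup>+\<eta>. \<integral>\<^sup>+\<xi>. norm (?f (t, \<eta>, \<xi>)) \<partial>lborel \<partial>lborel \<partial>lborel)"
  proof -
    have "sigma_finite_measure (lborel \<Otimes>\<^sub>M lborel :: (real \<times> real) measure)"
      unfolding lborel_prod by (rule sigma_finite_lborel)
    then have "(\<integral>\<^sup>+t. \<integral>\<^sup>+w. norm (?f (t, w)) \<partial>(lborel \<Otimes>\<^sub>M lborel) \<partial>lborel)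
        = (\<integral>\<^sup>+z. norm (?f z) \<partial>(lborel \<Otimes>\<^sub>M (lborel \<Otimes>\<^sub>M lborel)))"
      by (rule sigma_finite_measure.nn_integral_fst) (use meas in measurable)
    moreover have "(\<integral>\<^sup>+\<eta>. \<integral>\<^sup>+\<xi>. norm (?f (t, \<eta>, \<xi>)) \<partial>lborel \<partial>lborel)
        = (\<integral>\<^sup>+w. norm (?f (t, w)) \<partial>(lborel \<Otimes>\<^sub>M lborel))" for t
      by (rule lborel.nn_integral_fst) (simp only: case_prod_unfold fst_conv snd_conv, measurable)
    ultimately show ?thesis by simp
  qed
  also have "\<dots> \<le> (\<integral>\<^sup>+(t::real). ennreal (C * K) * ennreal L * indicator {0..1} t \<partial>lborel)"
    by (rule nn_integral_mono) (rule mid)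
  also have "\<dots> = ennreal (C * K) * ennreal L"
    by (simp add: nn_integral_cmult_indicator)
  also have "\<dots> < \<infinity>" by (simp add: ennreal_mult_less_top)
  finally show "(\<integral>\<^sup>+z. norm (?f z) \<partial>(lborel \<Otimes>\<^sub>M (lborel \<Otimes>\<^sub>M lborel))) < \<infinity>" .
qed

section \<open>The winding kernel on a long horizontal segment\<close>

lemma winding_kernel_line_integral:
  fixes v w :: complex and A \<eta> :: real
  assumes "0 \<le> A" "\<eta> \<noteq> Im w"
  defines "b \<equiv> Im w - \<eta>"
  shows "(\<integral>\<xi>. indicator {-A..A} \<xi> * Im (v / (w - Complex \<xi> \<eta>)) \<partial>lborel) =
    Im v / 2 * (ln ((Re w + A)\<^sup>2 + b\<^sup>2) - ln ((Re w - A)\<^sup>2 + b\<^sup>2)) +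
    Re v * (arctan ((Re w - A) / b) - arctan ((Re w + A) / b))"
proof -
  have "b \<noteq> 0" using assms by auto
  define F where "F = (\<lambda>\<xi>. Re v * arctan ((Re w - \<xi>) / b) - Im v / 2 * ln ((Re w - \<xi>)\<^sup>2 + b\<^sup>2))"
  have pos: "(Re w - \<xi>)\<^sup>2 + b\<^sup>2 > 0" for \<xi>
    using \<open>b \<noteq> 0\<close> by (simp add: add_nonneg_pos)
  have kernel: "Im (v / (w - Complex \<xi> \<eta>)) = (Im v * (Re w - \<xi>) - Re v * b) / ((Re w - \<xi>)\<^sup>2 + b\<^sup>2)" for \<xi>
    by (simp add: Im_divide b_def)
  have split: "x * (- b / D) - y / 2 * (- 2 * u / D) = (y * u - x * b) / D" for x y u D :: real
    by (cases "D = 0") (simp_all add: field_simps)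
  have arctan_deriv: "((\<lambda>\<xi>. arctan ((Re w - \<xi>) / b)) has_real_derivative - b / ((Re w - \<xi>)\<^sup>2 + b\<^sup>2)) (at \<xi>)" for \<xi>
  proof -
    have "((\<lambda>\<xi>. arctan ((Re w - \<xi>) / b)) has_real_derivative inverse (1 + ((Re w - \<xi>) / b)\<^sup>2) * (- 1 / b)) (at \<xi>)"
      using \<open>b \<noteq> 0\<close> by (auto intro!: derivative_eq_intros)
    moreover have "inverse (1 + ((Re w - \<xi>) / b)\<^sup>2) * (- 1 / b) = - b / ((Re w - \<xi>)\<^sup>2 + b\<^sup>2)"
    proof -
      have "1 + ((Re w - \<xi>) / b)\<^sup>2 = ((Re w - \<xi>)\<^sup>2 + b\<^sup>2) / b\<^sup>2"
        using \<open>b \<noteq> 0\<close> by (simp add: field_simps)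
      then show ?thesis using \<open>b \<noteq> 0\<close> by (simp add: power2_eq_square)
    qed
    ultimately show ?thesis by simp
  qed
  have "(\<integral>\<xi>. Im (v / (w - Complex \<xi> \<eta>)) * indicator {-A..A} \<xi> \<partial>lborel) = F A - F (- A)"
  proof (rule integral_FTC_Icc_real)
    fix \<xi> :: real
    have "(F has_real_derivative Re v * (- b / ((Re w - \<xi>)\<^sup>2 + b\<^sup>2)) -
        Im v / 2 * (- 2 * (Re w - \<xi>) / ((Re w - \<xi>)\<^sup>2 + b\<^sup>2))) (at \<xi>)"
      unfolding F_def
    proof (intro DERIV_diff DERIV_cmult arctan_deriv)
      show "((\<lambda>\<xi>. ln ((Re w - \<xi>)\<^sup>2 + b\<^sup>2)) has_real_derivative
          - 2 * (Re w - \<xi>) / ((Re w - \<xi>)\<^sup>2 + b\<^sup>2)) (at \<xi>)"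
        using pos[of \<xi>] by (auto intro!: derivative_eq_intros)
    qed
    also have "Re v * (- b / ((Re w - \<xi>)\<^sup>2 + b\<^sup>2)) - Im v / 2 * (- 2 * (Re w - \<xi>) / ((Re w - \<xi>)\<^sup>2 + b\<^sup>2))
        = Im (v / (w - Complex \<xi> \<eta>))"
      unfolding kernel by (rule split)
    finally show "(F has_real_derivative Im (v / (w - Complex \<xi> \<eta>))) (at \<xi>)" .
    show "isCont (\<lambda>\<xi>. Im (v / (w - Complex \<xi> \<eta>))) \<xi>"
      unfolding kernel by (intro continuous_intros) (rule less_imp_neq[OF pos, symmetric])
  qed (use assms in auto)
  then have "(\<integral>\<xi>. indicator {-A..A} \<xi> * Im (v / (w - Complex \<xi> \<eta>)) \<partial>lborel) = F A - F (- A)"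
    by (simp only: mult.commute)
  also have "\<dots> = Im v / 2 * (ln ((Re w + A)\<^sup>2 + b\<^sup>2) - ln ((Re w - A)\<^sup>2 + b\<^sup>2)) +
      Re v * (arctan ((Re w - A) / b) - arctan ((Re w + A) / b))"
    unfolding F_def diff_minus_eq_add right_diff_distrib by linarith
  finally show ?thesis .
qed

text \<open>
  The two terms of the closed form stay bounded uniformly in \<open>\<eta>\<close> and in the length of the segment,
  even when \<open>\<eta>\<close> approaches the height of \<open>w\<close>; the constant \<open>9\<close> bounds \<open>((A + \<bar>Re w\<bar>) / (A - \<bar>Re w\<bar>))\<^sup>2\<close>
  for \<open>\<bar>Re w\<bar> \<le> A / 2\<close>. This is the domination for the limit of long segments.
\<close>
lemma winding_kernel_line_integral_bound:
  fixes v w :: complex and A \<eta> :: real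
  assumes "norm w \<le> B" "0 < B" "2 * B \<le> A" "\<eta> \<noteq> Im w"
  shows "\<bar>\<integral>\<xi>. indicator {-A..A} \<xi> * Im (v / (w - Complex \<xi> \<eta>)) \<partial>lborel\<bar> \<le> (ln 9 / 2 + pi) * norm v"
proof -
  define b where "b = Im w - \<eta>"
  have "b \<noteq> 0" using assms by (auto simp: b_def)
  have Re: "\<bar>Re w\<bar> \<le> B" using assms abs_Re_le_cmod[of w] by linarith
  have pos: "(Re w - A)\<^sup>2 + b\<^sup>2 > 0" "(Re w + A)\<^sup>2 + b\<^sup>2 > 0"
    using \<open>b \<noteq> 0\<close> by (auto simp: add_nonneg_pos)
  have le9: "u\<^sup>2 + b\<^sup>2 \<le> 9 * (v\<^sup>2 + b\<^sup>2)" if "\<bar>u\<bar> \<le> 3 * \<bar>v\<bar>" for u v :: real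
  proof -
    have "u\<^sup>2 \<le> (3 * v)\<^sup>2" using that by (subst abs_le_square_iff[symmetric]) (auto simp: abs_mult)
    then show ?thesis by (simp add: power_mult_distrib) (smt (verit) zero_le_power2)
  qed
  have ln9: "ln x \<le> ln 9 + ln y" if "0 < x" "0 < y" "x \<le> 9 * y" for x y :: real
    using that ln_mono[of x "9 * y"] by (simp add: ln_mult)
  have "\<bar>ln ((Re w + A)\<^sup>2 + b\<^sup>2) - ln ((Re w - A)\<^sup>2 + b\<^sup>2)\<bar> \<le> ln 9"
  proof -
    have "\<bar>Re w - A\<bar> \<le> 3 * \<bar>Re w + A\<bar>" "\<bar>Re w + A\<bar> \<le> 3 * \<bar>Re w - A\<bar>"
      using Re assms(2,3) by (smt (verit))+
    then show ?thesis
      using ln9[OF pos le9] ln9[OF pos(2,1) le9] by linarith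
  qed
  moreover have "\<bar>Im v\<bar> \<le> norm v" by (rule abs_Im_le_cmod)
  ultimately have 1: "\<bar>Im v * (ln ((Re w + A)\<^sup>2 + b\<^sup>2) - ln ((Re w - A)\<^sup>2 + b\<^sup>2))\<bar> \<le> norm v * ln 9"
    unfolding abs_mult by (intro mult_mono) auto
  have "\<bar>arctan ((Re w - A) / b) - arctan ((Re w + A) / b)\<bar> \<le> pi"
    using arctan_bounded[of "(Re w - A) / b"] arctan_bounded[of "(Re w + A) / b"] by linarith
  moreover have "\<bar>Re v\<bar> \<le> norm v" by (rule abs_Re_le_cmod)
  ultimately have 2: "\<bar>Re v * (arctan ((Re w - A) / b) - arctan ((Re w + A) / b))\<bar> \<le> norm v * pi"
    unfolding abs_mult by (intro mult_mono) auto
  have "0 \<le> A" using assms by linarith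
  show ?thesis
    unfolding winding_kernel_line_integral[OF \<open>0 \<le> A\<close> assms(4)] b_def[symmetric]
    using 1 2 unfolding distrib_right times_divide_eq_left mult.commute[of "norm v"] by linarith
qed

text \<open>
  As the segment grows to a full line, the logarithms cancel and the arc tangents jump by \<open>\<pi>\<close>:
  a horizontal line only sees on which side of it the point \<open>w\<close> lies.
\<close>
lemma winding_kernel_line_integral_tendsto:
  fixes v w :: complex and \<eta> :: real
  assumes "\<eta> \<noteq> Im w"
  shows "(\<lambda>n. \<integral>\<xi>. indicator {-real n..real n} \<xi> * Im (v / (w - Complex \<xi> \<eta>)) \<partial>lborel)
      \<longlonglongrightarrow> - pi * Re v * sgn (Im w - \<eta>)"
proof -
  define b where "b = Im w - \<eta>"
  define x where "x = Re w"
  have "b \<noteq> 0" using assms by (auto simp: b_def)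
  have "(\<lambda>n. ln ((x + real n)\<^sup>2 + b\<^sup>2) - ln ((x - real n)\<^sup>2 + b\<^sup>2)) \<longlonglongrightarrow> 0"
    by real_asymp
  moreover have "(\<lambda>n. arctan ((x - real n) / b) - arctan ((x + real n) / b)) \<longlonglongrightarrow> - pi * sgn b"
  proof (cases "b > 0")
    case True
    then show ?thesis by real_asymp
  next
    case False
    then have "b < 0" using \<open>b \<noteq> 0\<close> by auto
    then show ?thesis by real_asymp
  qed
  ultimately have "(\<lambda>n. Im v / 2 * (ln ((x + real n)\<^sup>2 + b\<^sup>2) - ln ((x - real n)\<^sup>2 + b\<^sup>2)) +
      Re v * (arctan ((x - real n) / b) - arctan ((x + real n) / b))) \<longlonglongrightarrow> Im v / 2 * 0 + Re v * (- pi * sgn b)"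
    by (intro tendsto_intros)
  then show ?thesis
    unfolding winding_kernel_line_integral[OF of_nat_0_le_iff assms] b_def x_def
    by (simp add: mult.assoc mult.left_commute)
qed

section \<open>The area enclosed by a closed curve\<close>

text \<open>
  The coordinates are ordered as \<open>(\<eta>, \<xi>)\<close>, height first, to match the order of integration.
\<close>
lemma AE_not_in_smooth_curve:
  fixes p p' :: "real \<Rightarrow> complex"
  assumes deriv: "\<And>t. (p has_vector_derivative p' t) (at t)"
  shows "AE z in lborel \<Otimes>\<^sub>M lborel. Complex (snd z) (fst z) \<notin> p ` {0..1}"
proof -
  define q where "q = (\<lambda>t. (Im (p t), Re (p t)))"
  have q: "z \<in> q ` {0..1} \<longleftrightarrow> Complex (snd z) (fst z) \<in> p ` {0..1}" for z
    by (cases z) (auto simp: q_def image_iff complex_eq_iff)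
  have "(q has_vector_derivative (Im (p' t), Re (p' t))) (at t)" for t
    unfolding q_def by (intro has_vector_derivative_Pair deriv
          bounded_linear.has_vector_derivative[OF bounded_linear_Re]
          bounded_linear.has_vector_derivative[OF bounded_linear_Im])
  then have dq: "q differentiable (at t)" for t
    by (rule differentiableI_vector)
  have "negligible (q ` {0..1})"
    by (rule negligible_differentiable_image_lowdim)
       (auto simp: differentiable_on_def intro: differentiable_at_withinI dq)
  moreover have "compact (q ` {0..1})"
    by (intro compact_continuous_image continuous_at_imp_continuous_on ballI
          differentiable_imp_continuous_within dq) auto
  then have "q ` {0..1} \<in> sets borel" by (intro borel_closed compact_imp_closed)
  ultimately have "q ` {0..1} \<in> null_sets lborel"
    by (simp add: negligible_iff_null_sets null_sets_completion_iff)
  then have "AE z in lborel. z \<notin> q ` {0..1}" by (rule AE_not_in)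
  then show ?thesis unfolding lborel_prod q .
qed

lemma integral_sgn_diff:
  fixes y B :: real
  assumes "\<bar>y\<bar> \<le> B"
  shows "(\<integral>\<eta>. indicator {-B..B} \<eta> * sgn (y - \<eta>) \<partial>lborel) = 2 * y"
proof -
  have "integrable lborel (\<lambda>\<eta>. indicator {-B..B} \<eta> * sgn (y - \<eta>))"
    by (rule Bochner_Integration.integrable_bound[where f = "indicator {-B..B} :: real \<Rightarrow> real"])
       (auto simp: indicator_def sgn_if emeasure_lborel_Icc_eq)
  then have "((\<lambda>\<eta>. indicator {-B..B} \<eta> * sgn (y - \<eta>)) has_integral
      (\<integral>\<eta>. indicator {-B..B} \<eta> * sgn (y - \<eta>) \<partial>lborel)) UNIV"
    by (rule has_integral_integral_lborel)
  moreover have "((\<lambda>\<eta>. sgn (y - \<eta>)) has_integral (- \<bar>y - B\<bar> - (- \<bar>y - (- B)\<bar>))) {-B..B}"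
  proof (rule fundamental_theorem_of_calculus_interior_strong[where S = "{y}"])
    show "continuous_on {-B..B} (\<lambda>\<eta>. - \<bar>y - \<eta>\<bar>)" by (intro continuous_intros)
    fix \<eta> assume "\<eta> \<in> {-B<..<B} - {y}"
    then consider "\<eta> < y" | "y < \<eta>" by fastforce
    then have "((\<lambda>\<eta>. - \<bar>y - \<eta>\<bar>) has_real_derivative sgn (y - \<eta>)) (at \<eta>)"
    proof cases
      case 1
      have "((\<lambda>\<eta>. \<eta> - y) has_real_derivative sgn (y - \<eta>)) (at \<eta>)"
        using 1 by (auto intro!: derivative_eq_intros)
      then show ?thesis
        by (rule has_field_derivative_transform_within_open[where S = "{..<y}"]) (use 1 in auto)
    next
      case 2
      have "((\<lambda>\<eta>. y - \<eta>) has_real_derivative sgn (y - \<eta>)) (at \<eta>)"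
        using 2 by (auto intro!: derivative_eq_intros)
      then show ?thesis
        by (rule has_field_derivative_transform_within_open[where S = "{y<..}"]) (use 2 in auto)
    qed
    then show "((\<lambda>\<eta>. - \<bar>y - \<eta>\<bar>) has_vector_derivative sgn (y - \<eta>)) (at \<eta>)"
      by (simp add: has_real_derivative_iff_has_vector_derivative)
  qed (use assms in auto)
  then have "((\<lambda>\<eta>. indicator {-B..B} \<eta> * sgn (y - \<eta>)) has_integral (- \<bar>y - B\<bar> - (- \<bar>y - (- B)\<bar>))) UNIV"
    by (subst (asm) has_integral_restrict_UNIV[symmetric])
       (auto simp: indicator_def if_distrib cong: if_cong elim!: has_integral_eq[rotated])
  ultimately have "(\<integral>\<eta>. indicator {-B..B} \<eta> * sgn (y - \<eta>) \<partial>lborel) = - \<bar>y - B\<bar> - (- \<bar>y - (- B)\<bar>)"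
    by (rule has_integral_unique)
  then show ?thesis using assms by auto
qed

text \<open>
  The signed area \<open>1/2 \<integral> Im (cnj p * p')\<close> is the integral of the winding number over the plane, so it
  cannot be positive when no winding number is. To see this, the winding number is integrated over the
  rectangle \<open>\<bar>\<xi>\<bar> \<le> n\<close>, \<open>\<bar>\<eta>\<bar> \<le> B\<close> and the orders of integration are exchanged, so that the
  integral over \<open>\<xi>\<close> is innermost. For \<open>n \<rightarrow> \<infinity>\<close> it tends to \<open>- \<pi> * Re p' * sgn (Im p - \<eta>)\<close>; integrating this
  over \<open>\<eta>\<close> leaves \<open>- 2 \<pi> * Re p' * Im p\<close>, and \<open>- \<integral> y dx\<close> is the area.
\<close>
theorem closed_curve_area_nonpos:
  fixes p p' :: "real \<Rightarrow> complex"
  assumes deriv: "\<And>t. (p has_vector_derivative p' t) (at t)"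
    and cont': "continuous_on UNIV p'"
    and closed: "p 0 = p 1"
    and wind: "\<And>\<zeta>. \<zeta> \<notin> p ` {0..1} \<Longrightarrow> Im (integral {0..1} (\<lambda>t. p' t / (p t - \<zeta>))) \<le> 0"
  shows "Im (integral {0..1} (\<lambda>t. cnj (p t) * p' t)) \<le> 0"
proof -
  have cont: "continuous_on UNIV p"
    using deriv by (meson continuous_at_imp_continuous_on has_vector_derivative_continuous)
  have contI: "continuous_on {0..1} p" "continuous_on {0..1} p'"
    using cont cont' by (auto intro: continuous_on_subset)
  have [measurable]: "p \<in> borel_measurable borel" "p' \<in> borel_measurable borel"
    using cont cont' by (auto intro: borel_measurable_continuous_onI)
  have "bounded (p ` {0..1})" "bounded (p' ` {0..1})"
    by (intro compact_imp_bounded compact_continuous_image contI compact_Icc)+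
  then obtain B0 C where "\<forall>v \<in> p ` {0..1}. norm v \<le> B0" "\<forall>v \<in> p' ` {0..1}. norm v \<le> C"
    unfolding bounded_iff by blast
  then have B0: "norm (p t) \<le> B0" and C: "norm (p' t) \<le> C" if "t \<in> {0..1}" for t
    using that by blast+
  \<comment> \<open>The summand 1 keeps the rectangle nondegenerate when the curve is constant at 0.\<close>
  define B where "B = B0 + 1"
  have B: "norm (p t) \<le> B" if "t \<in> {0..1}" for t
    using B0[OF that] by (simp add: B_def)
  have "0 \<le> B0" "0 \<le> C" by (rule order_trans[OF norm_ge_zero B0[of 0]] order_trans[OF norm_ge_zero C[of 0]]; simp)+
  then have "0 < B" by (simp add: B_def)
  interpret P: pair_sigma_finite "lborel :: real measure" "lborel \<Otimes>\<^sub>M lborel :: (real \<times> real) measure"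
    unfolding lborel_prod ..
  define f where "f = (\<lambda>n :: nat. \<lambda>t (\<eta>, \<xi>). indicator {0..1} t * (indicator {-B..B} \<eta> *
      (indicator {-real n..real n} \<xi> * Im (p' t / (p t - Complex \<xi> \<eta>)))))"
  define I where "I = (\<lambda>n \<eta> t. \<integral>\<xi>. indicator {-real n..real n} \<xi> * Im (p' t / (p t - Complex \<xi> \<eta>)) \<partial>lborel)"
  define \<Psi> where "\<Psi> = (\<lambda>n t. indicator {0..1} t * (\<integral>\<eta>. indicator {-B..B} \<eta> * I n \<eta> t \<partial>lborel))"
  have f_int: "integrable (lborel \<Otimes>\<^sub>M (lborel \<Otimes>\<^sub>M lborel)) (\<lambda>(t, z). f n t z)" if "B \<le> real n" for n
    using winding_kernel_integrable[OF cont cont' B that] by (simp add: f_def case_prod_unfold)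
  have [measurable]: "(\<lambda>(\<eta>, t). I n \<eta> t) \<in> borel_measurable (lborel \<Otimes>\<^sub>M lborel)" for n
    unfolding I_def case_prod_beta by measurable
  have \<Psi>_meas [measurable]: "\<Psi> n \<in> borel_measurable lborel" for n
    unfolding \<Psi>_def by measurable
  have \<Psi>_nonpos: "(\<integral>t. \<Psi> n t \<partial>lborel) \<le> 0" if n: "B \<le> real n" for n
  proof -
    have "(\<integral>t. \<Psi> n t \<partial>lborel) = (\<integral>t. (\<integral>z. f n t z \<partial>(lborel \<Otimes>\<^sub>M lborel)) \<partial>lborel)"
    proof (rule integral_cong_AE)
      show "(\<lambda>t. \<integral>z. f n t z \<partial>(lborel \<Otimes>\<^sub>M lborel)) \<in> borel_measurable lborel"
        using P.integrable_fst'[OF f_int[OF n]] by (auto simp: dest: borel_measurable_integrable)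
      have "AE t in lborel. integrable (lborel \<Otimes>\<^sub>M lborel) (\<lambda>z. f n t z)"
        using P.AE_integrable_fst'[OF f_int[OF n]] by simp
      then show "AE t in lborel. \<Psi> n t = (\<integral>z. f n t z \<partial>(lborel \<Otimes>\<^sub>M lborel))"
      proof eventually_elim
        case (elim t)
        have "(\<integral>z. f n t z \<partial>(lborel \<Otimes>\<^sub>M lborel)) = (\<integral>\<eta>. (\<integral>\<xi>. f n t (\<eta>, \<xi>) \<partial>lborel) \<partial>lborel)"
          by (rule lborel_pair.integral_fst'[OF elim, symmetric])
        also have "\<dots> = \<Psi> n t"
          unfolding f_def \<Psi>_def I_def by simp
        finally show ?case by simp
      qed
    qed auto
    also have "\<dots> = (\<integral>z. (\<integral>t. f n t z \<partial>lborel) \<partial>(lborel \<Otimes>\<^sub>M lborel))"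
      by (rule P.Fubini_integral[OF f_int[OF n], symmetric])
    also have "\<dots> \<le> 0"
    proof -
      have "AE z in lborel \<Otimes>\<^sub>M lborel. 0 \<le> - (\<integral>t. f n t z \<partial>lborel)"
        using AE_not_in_smooth_curve[OF deriv]
      proof eventually_elim
        case (elim z)
        define \<zeta> where "\<zeta> = Complex (snd z) (fst z)"
        have off: "p t \<noteq> \<zeta>" if "t \<in> {0..1}" for t
          using elim that unfolding \<zeta>_def by (metis imageI)
        have c: "continuous_on {0..1} (\<lambda>t. p' t / (p t - \<zeta>))"
          using off by (intro continuous_intros contI) auto
        have "(\<integral>t. f n t z \<partial>lborel) = indicator {-B..B} (fst z) * (indicator {-real n..real n} (snd z) *
            (\<integral>t. indicator {0..1} t * Im (p' t / (p t - \<zeta>)) \<partial>lborel))"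
          unfolding f_def \<zeta>_def case_prod_unfold
          by (simp add: mult.left_commute[of "indicator {0..1} _"])
        also have "(\<integral>t. indicator {0..1} t * Im (p' t / (p t - \<zeta>)) \<partial>lborel)
            = integral {0..1} (\<lambda>t. Im (p' t / (p t - \<zeta>)))"
          using set_borel_integral_eq_integral(2)[OF borel_integrable_atLeastAtMost', of 0 1 "\<lambda>t. Im (p' t / (p t - \<zeta>))"]
            continuous_on_Im[OF c] by (simp add: set_lebesgue_integral_def)
        also have "\<dots> = Im (integral {0..1} (\<lambda>t. p' t / (p t - \<zeta>)))"
          using integral_linear[OF integrable_continuous_real[OF c] bounded_linear_Im]
          by (simp add: o_def)
        finally show ?case
          using wind[of \<zeta>] elim by (simp add: \<zeta>_def mult_nonneg_nonpos)
      qed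
      then have "0 \<le> (\<integral>z. - (\<integral>t. f n t z \<partial>lborel) \<partial>(lborel \<Otimes>\<^sub>M lborel))"
        by (rule integral_nonneg_AE)
      then show ?thesis by simp
    qed
    finally show ?thesis .
  qed
  have I_lim: "(\<lambda>n. I n \<eta> t) \<longlonglongrightarrow> - pi * Re (p' t) * sgn (Im (p t) - \<eta>)" if "\<eta> \<noteq> Im (p t)" for \<eta> t
    unfolding I_def by (rule winding_kernel_line_integral_tendsto[OF that])
  define M where "M = (ln 9 / 2 + pi) * C"
  have "0 \<le> M" unfolding M_def using \<open>0 \<le> C\<close> pi_gt_zero by (intro mult_nonneg_nonneg add_nonneg_nonneg) auto
  have I_bd: "\<bar>I n \<eta> t\<bar> \<le> M" if "\<eta> \<noteq> Im (p t)" "t \<in> {0..1}" "2 * B \<le> real n" for n \<eta> t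
  proof -
    have "\<bar>I n \<eta> t\<bar> \<le> (ln 9 / 2 + pi) * norm (p' t)"
      unfolding I_def by (rule winding_kernel_line_integral_bound[OF B[OF that(2)] \<open>0 < B\<close> that(3,1)])
    also have "\<dots> \<le> M"
      unfolding M_def using C[OF that(2)] pi_gt_zero by (intro mult_left_mono add_nonneg_nonneg) auto
    finally show ?thesis .
  qed
  have indB: "integrable lborel (\<lambda>\<eta>. indicator {-B..B} \<eta> * M)" and ind1: "integrable lborel (\<lambda>t. indicator {0..1::real} t * (2 * B * M))"
    by (auto intro!: integrable_mult_left simp: integrable_indicator_iff emeasure_lborel_Icc_eq)
  \<comment> \<open>The kernel bound needs \<open>2 * B \<le> n\<close>, so the sequences are shifted to start there.\<close>
  obtain n0 :: nat where n0: "2 * B \<le> real n0" using real_arch_simple by blast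
  have big: "2 * B \<le> real (n + n0)" for n using n0 by simp
  have \<Psi>_lim: "(\<lambda>n. \<Psi> (n + n0) t) \<longlonglongrightarrow> indicator {0..1} t * (- 2 * pi * (Re (p' t) * Im (p t)))" for t
  proof (cases "t \<in> {0..1}")
    case True
    have "(\<lambda>n. \<integral>\<eta>. indicator {-B..B} \<eta> * I (n + n0) \<eta> t \<partial>lborel)
        \<longlonglongrightarrow> (\<integral>\<eta>. indicator {-B..B} \<eta> * (- pi * Re (p' t) * sgn (Im (p t) - \<eta>)) \<partial>lborel)"
    proof (rule integral_dominated_convergence[OF _ _ indB])
      have ne: "AE \<eta> in lborel. \<eta> \<noteq> Im (p t)" by (rule AE_lborel_singleton)
      then show "AE \<eta> in lborel. (\<lambda>n. indicator {-B..B} \<eta> * I (n + n0) \<eta> t)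
          \<longlonglongrightarrow> indicator {-B..B} \<eta> * (- pi * Re (p' t) * sgn (Im (p t) - \<eta>))"
        by eventually_elim (intro tendsto_intros LIMSEQ_ignore_initial_segment[OF I_lim])
      show "AE \<eta> in lborel. norm (indicator {-B..B} \<eta> * I (n + n0) \<eta> t) \<le> indicator {-B..B} \<eta> * M" for n
        using ne by eventually_elim (auto simp: indicator_def intro: I_bd[OF _ True big])
    qed measurable
    also have "(\<integral>\<eta>. indicator {-B..B} \<eta> * (- pi * Re (p' t) * sgn (Im (p t) - \<eta>)) \<partial>lborel)
        = - pi * Re (p' t) * (\<integral>\<eta>. indicator {-B..B} \<eta> * sgn (Im (p t) - \<eta>) \<partial>lborel)"
      by (subst integral_mult_right_zero[symmetric]) (simp add: mult_ac)
    also have "\<dots> = - pi * Re (p' t) * (2 * Im (p t))"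
      using B[OF True] abs_Im_le_cmod[of "p t"] by (subst integral_sgn_diff) auto
    finally show ?thesis using True by (simp add: \<Psi>_def mult_ac)
  qed (simp add: \<Psi>_def)
  have \<Psi>_bd: "norm (\<Psi> (n + n0) t) \<le> indicator {0..1} t * (2 * B * M)" for n t
  proof (cases "t \<in> {0..1}")
    case True
    have "norm (\<integral>\<eta>. indicator {-B..B} \<eta> * I (n + n0) \<eta> t \<partial>lborel) \<le> (\<integral>\<eta>. indicator {-B..B} \<eta> * M \<partial>lborel)"
    proof (rule order_trans[OF integral_norm_bound], rule integral_mono_AE'[OF indB])
      show "AE \<eta> in lborel. norm (indicator {-B..B} \<eta> * I (n + n0) \<eta> t) \<le> indicator {-B..B} \<eta> * M"
        using AE_lborel_singleton[of "Im (p t)"]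
        by eventually_elim (auto simp: indicator_def intro: I_bd[OF _ True big])
    qed (use \<open>0 \<le> M\<close> in auto)
    also have "\<dots> = 2 * B * M" using \<open>0 < B\<close> by simp
    finally show ?thesis using True by (simp add: \<Psi>_def)
  qed (simp add: \<Psi>_def)
  have "(\<lambda>n. \<integral>t. \<Psi> (n + n0) t \<partial>lborel) \<longlonglongrightarrow> (\<integral>t. indicator {0..1} t * (- 2 * pi * (Re (p' t) * Im (p t))) \<partial>lborel)"
    by (rule integral_dominated_convergence[OF _ _ ind1]) (use \<Psi>_lim \<Psi>_bd in auto)
  moreover have "(\<integral>t. \<Psi> (n + n0) t \<partial>lborel) \<le> 0" for n
    using big[of n] \<open>0 < B\<close> by (intro \<Psi>_nonpos) linarith
  ultimately have "(\<integral>t. indicator {0..1} t * (- 2 * pi * (Re (p' t) * Im (p t))) \<partial>lborel) \<le> 0"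
    by (intro LIMSEQ_le_const2) auto
  also have "(\<integral>t. indicator {0..1} t * (- 2 * pi * (Re (p' t) * Im (p t))) \<partial>lborel)
      = integral {0..1} (\<lambda>t. - 2 * pi * (Re (p' t) * Im (p t)))"
  proof -
    have "continuous_on {0..1} (\<lambda>t. - 2 * pi * (Re (p' t) * Im (p t)))"
      by (intro continuous_intros contI)
    from set_borel_integral_eq_integral(2)[OF borel_integrable_atLeastAtMost'[OF this]]
    show ?thesis by (simp only: set_lebesgue_integral_def real_scaleR_def)
  qed
  also have "\<dots> = - 2 * pi * integral {0..1} (\<lambda>t. Re (p' t) * Im (p t))"
    by (rule integral_mult_right)
  finally have nonneg: "0 \<le> integral {0..1} (\<lambda>t. Re (p' t) * Im (p t))"
    using pi_gt_zero by (simp add: zero_le_mult_iff)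
  have "((\<lambda>t. Re (p' t) * Im (p t) + Re (p t) * Im (p' t)) has_integral
      (Re (p 1) * Im (p 1) - Re (p 0) * Im (p 0))) {0..1}"
  proof (rule fundamental_theorem_of_calculus)
    fix t :: real
    have "((\<lambda>t. Re (p t)) has_real_derivative Re (p' t)) (at t within {0..1})"
         "((\<lambda>t. Im (p t)) has_real_derivative Im (p' t)) (at t within {0..1})"
      unfolding has_real_derivative_iff_has_vector_derivative
      by (auto intro!: bounded_linear.has_vector_derivative[OF bounded_linear_Re]
          bounded_linear.has_vector_derivative[OF bounded_linear_Im] has_vector_derivative_at_within[OF deriv])
    from DERIV_mult'[OF this]
    show "((\<lambda>t. Re (p t) * Im (p t)) has_vector_derivative Re (p' t) * Im (p t) + Re (p t) * Im (p' t))
        (at t within {0..1})"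
      by (simp add: has_real_derivative_iff_has_vector_derivative add.commute)
  qed simp
  then have sum0: "integral {0..1} (\<lambda>t. Re (p' t) * Im (p t) + Re (p t) * Im (p' t)) = 0"
    using closed by (simp add: integral_unique)
  have ints: "(\<lambda>t. Re (p' t) * Im (p t)) integrable_on {0..1}" "(\<lambda>t. Re (p t) * Im (p' t)) integrable_on {0..1}"
    by (auto intro!: integrable_continuous_real continuous_intros contI)
  have "Im (integral {0..1} (\<lambda>t. cnj (p t) * p' t)) = integral {0..1} (\<lambda>t. Im (cnj (p t) * p' t))"
    by (subst integral_linear[OF _ bounded_linear_Im, symmetric])
       (auto simp: o_def intro!: integrable_continuous_real continuous_intros contI)
  also have "\<dots> = integral {0..1} (\<lambda>t. (Re (p' t) * Im (p t) + Re (p t) * Im (p' t)) - 2 * (Re (p' t) * Im (p t)))"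
    by (intro integral_cong) (simp add: algebra_simps)
  also have "\<dots> = integral {0..1} (\<lambda>t. Re (p' t) * Im (p t) + Re (p t) * Im (p' t))
      - 2 * integral {0..1} (\<lambda>t. Re (p' t) * Im (p t))"
    using ints by (subst integral_diff) (auto intro!: integrable_add)
  finally show ?thesis using sum0 nonneg by simp
qed

section \<open>Winding numbers of polynomials in a reciprocal\<close>

text \<open>
  The argument principle for an injective function: \<open>w\<close> is taken at most once, and then to first order
  because the derivative of an injective function has no zeros.
\<close>
lemma has_contour_integral_log_deriv_injective:
  assumes holG: "G holomorphic_on ball 0 1" and inj: "inj_on G (ball 0 1)"
    and r: "0 < r" "r < 1" and off: "w \<notin> G ` sphere 0 r"
  shows "((\<lambda>z. deriv G z / (G z - w)) has_contour_integral
           2 * of_real pi * \<i> * (if w \<in> G ` ball 0 r then 1 else 0)) (circlepath 0 r)"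
proof (cases "w \<in> G ` ball 0 r")
  case False
  have "cball 0 r = ball 0 r \<union> sphere (0::complex) r" by auto
  then have nz: "G z \<noteq> w" if "z \<in> cball 0 r" for z
    using False off that by auto
  have "((\<lambda>z. deriv G z / (G z - w)) has_contour_integral 0) (circlepath 0 r)"
  proof (rule Cauchy_theorem_convex_simple)
    show "(\<lambda>z. deriv G z / (G z - w)) holomorphic_on cball 0 r"
      using r nz by (intro holomorphic_intros holomorphic_on_subset[OF holomorphic_deriv[OF holG]]
          holomorphic_on_subset[OF holG]) auto
  qed (use r in auto)
  then show ?thesis using False by simp
next
  case True
  then obtain z0 where z0: "norm z0 < r" "w = G z0" by auto
  \<comment> \<open>Split off the zero: \<open>G - w = (z - z0) * K\<close> with \<open>K\<close> free of zeros.\<close>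
  define K where "K = (\<lambda>z. if z = z0 then deriv G z0 else (G z - G z0) / (z - z0))"
  have holK: "K holomorphic_on ball 0 1"
    unfolding K_def by (rule pole_lemma_open[OF holG]) auto
  have G_eq: "G z - w = (z - z0) * K z" for z
    by (auto simp: K_def z0)
  have K_nz: "K z \<noteq> 0" if "z \<in> ball 0 1" for z
    using that z0 r inj holomorphic_injective_imp_regular[OF holG _ inj, of z0]
    by (auto simp: K_def inj_on_def)
  have deriv_G: "deriv G z = K z + (z - z0) * deriv K z" if "z \<in> ball 0 1" for z
  proof -
    have "(K has_field_derivative deriv K z) (at z)"
      using holK that by (intro holomorphic_derivI) auto
    then have "((\<lambda>z. w + (z - z0) * K z) has_field_derivative (K z + (z - z0) * deriv K z)) (at z)"
      by (auto intro!: derivative_eq_intros)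
    moreover have "(\<lambda>z. w + (z - z0) * K z) = G"
      by (simp add: G_eq[symmetric])
    ultimately show ?thesis by (simp add: DERIV_imp_deriv)
  qed
  have "((\<lambda>z. deriv K z / K z) has_contour_integral 0) (circlepath 0 r)"
  proof (rule Cauchy_theorem_convex_simple)
    show "(\<lambda>z. deriv K z / K z) holomorphic_on cball 0 r"
      using r K_nz by (intro holomorphic_intros holomorphic_on_subset[OF holomorphic_deriv[OF holK]]
          holomorphic_on_subset[OF holK]) auto
  qed (use r in auto)
  moreover have "((\<lambda>z. 1 / (z - z0)) has_contour_integral (2 * of_real pi * \<i> * 1)) (circlepath 0 r)"
    by (rule Cauchy_integral_circlepath_simple) (use z0 in auto)
  ultimately have "((\<lambda>z. 1 / (z - z0) + deriv K z / K z) has_contour_integral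
      (2 * of_real pi * \<i> * 1 + 0)) (circlepath 0 r)"
    by (intro has_contour_integral_add)
  then have "((\<lambda>z. deriv G z / (G z - w)) has_contour_integral (2 * of_real pi * \<i> * 1 + 0)) (circlepath 0 r)"
  proof (rule has_contour_integral_eq)
    fix z assume "z \<in> path_image (circlepath 0 r)"
    then have z: "norm z = r" using r by auto
    then have "z \<noteq> z0" "z \<in> ball 0 1" using z0 r by auto
    then show "1 / (z - z0) + deriv K z / K z = deriv G z / (G z - w)"
      using K_nz[of z] by (simp add: G_eq deriv_G field_simps)
  qed
  then show ?thesis using True by simp
qed

text \<open>
  Univalence enters the area argument here. Each linear factor \<open>1 / F - u\<close> of \<open>P (1 / F)\<close> has one simple
  pole, at the origin, and at most one simple zero, where \<open>F = 1 / u\<close>. Hence every factor contributes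
  \<open>-1\<close> or \<open>0\<close> to the winding number, and the total is never positive.
\<close>
lemma has_contour_integral_log_deriv_poly_inverse:
  fixes P :: "complex poly"
  assumes holF: "F holomorphic_on ball 0 1" and inj: "inj_on F (ball 0 1)" and F0: "F 0 = 0"
    and r: "0 < r" "r < 1" and nz: "\<And>z. norm z = r \<Longrightarrow> poly P (1 / F z) \<noteq> 0"
  shows "\<exists>m :: nat. ((\<lambda>z. - deriv F z / (F z)\<^sup>2 * poly (pderiv P) (1 / F z) / poly P (1 / F z))
           has_contour_integral - (2 * of_real pi * \<i> * of_nat m)) (circlepath 0 r)"
  using nz
proof (induction "degree P" arbitrary: P rule: less_induct)
  case (less P)
  have F_nz: "F z \<noteq> 0" if "norm z = r" for z
  proof
    assume "F z = 0"
    then have "z = 0" using inj F0 that r by (auto simp: inj_on_def)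
    then show False using that r by simp
  qed
  show ?case
  proof (cases "degree P = 0")
    case True
    then have "pderiv P = 0" by (simp add: pderiv_eq_0_iff)
    then show ?thesis by (intro exI[of _ 0]) (simp add: has_contour_integral_0)
  next
    case False
    then obtain u where "poly P u = 0"
      using alg_closed_imp_poly_has_root[of P] by auto
    then obtain R where P: "P = [:-u, 1:] * R" by (auto simp: poly_eq_0_iff_dvd)
    have "R \<noteq> 0" using P False by auto
    then have deg: "degree R < degree P" unfolding P by (subst degree_mult_eq) auto
    have P_eval: "poly P x = (x - u) * poly R x" for x by (simp add: P algebra_simps)
    have P'_eval: "poly (pderiv P) x = poly R x + (x - u) * poly (pderiv R) x" for x
      unfolding P pderiv_mult by (simp add: pderiv_pCons algebra_simps)
    have nzR: "poly R (1 / F z) \<noteq> 0" "1 / F z \<noteq> u" if "norm z = r" for z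
      using less.prems[OF that] by (auto simp: P_eval)
    obtain m where m: "((\<lambda>z. - deriv F z / (F z)\<^sup>2 * poly (pderiv R) (1 / F z) / poly R (1 / F z))
           has_contour_integral - (2 * of_real pi * \<i> * of_nat m)) (circlepath 0 r)"
      using less.hyps[OF deg nzR(1)] by auto
    have F'F: "((\<lambda>z. deriv F z / (F z - 0)) has_contour_integral
           2 * of_real pi * \<i> * (if 0 \<in> F ` ball 0 r then 1 else 0)) (circlepath 0 r)"
      by (rule has_contour_integral_log_deriv_injective[OF holF inj r]) (use F_nz in auto)
    have "0 \<in> F ` ball 0 r" using F0 r by (auto intro!: image_eqI[of _ _ 0])
    then have pole: "((\<lambda>z. deriv F z / F z) has_contour_integral 2 * of_real pi * \<i>) (circlepath 0 r)"
      using F'F by simp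
    \<comment> \<open>\<open>k\<close> counts the zeros of \<open>1 / F - u\<close>; there are none for \<open>u = 0\<close>, as \<open>1 / F\<close> never vanishes.\<close>
    obtain k :: nat where k: "k \<le> 1" and "((\<lambda>z. if u = 0 then 0 else deriv F z / (F z - 1 / u)) has_contour_integral
           2 * of_real pi * \<i> * of_nat k) (circlepath 0 r)"
    proof (cases "u = 0")
      case True
      then show ?thesis by (intro that[of 0]) (auto simp: has_contour_integral_0)
    next
      case u: False
      have "1 / u \<notin> F ` sphere 0 r"
      proof
        assume "1 / u \<in> F ` sphere 0 r"
        then obtain z where "norm z = r" "F z = 1 / u" by auto
        then show False using nzR(2)[of z] by simp
      qed
      from has_contour_integral_log_deriv_injective[OF holF inj r this] show ?thesis
        using u by (intro that[of "if 1 / u \<in> F ` ball 0 r then 1 else 0"]) (auto split: if_splits)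
    qed
    then have "((\<lambda>z. - (deriv F z / F z) + (if u = 0 then 0 else deriv F z / (F z - 1 / u))
          + - deriv F z / (F z)\<^sup>2 * poly (pderiv R) (1 / F z) / poly R (1 / F z))
        has_contour_integral (- (2 * of_real pi * \<i>) + 2 * of_real pi * \<i> * of_nat k
          + - (2 * of_real pi * \<i> * of_nat m))) (circlepath 0 r)"
      by (intro has_contour_integral_add has_contour_integral_neg pole m)
    then have "((\<lambda>z. - deriv F z / (F z)\<^sup>2 * poly (pderiv P) (1 / F z) / poly P (1 / F z))
        has_contour_integral (- (2 * of_real pi * \<i>) + 2 * of_real pi * \<i> * of_nat k
          + - (2 * of_real pi * \<i> * of_nat m))) (circlepath 0 r)"
    proof (rule has_contour_integral_eq)
      fix z assume "z \<in> path_image (circlepath 0 r)"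
      then have z: "norm z = r" using r by auto
      define x where "x = 1 / F z"
      have x: "x \<noteq> 0" "x \<noteq> u" "poly R x \<noteq> 0" "F z = 1 / x"
        using F_nz[OF z] nzR[OF z] by (auto simp: x_def)
      have factor: "- (deriv F z / F z) + (if u = 0 then 0 else deriv F z / (F z - 1 / u))
          = - deriv F z / (F z)\<^sup>2 / (x - u)"
      proof (cases "u = 0")
        case True
        then show ?thesis using x by (simp add: field_simps power2_eq_square)
      next
        case False
        have "1 / x - 1 / u \<noteq> 0" "u - x \<noteq> 0" "x - u \<noteq> 0" using x False by (auto simp: field_simps)
        then have "deriv F z / (1 / x - 1 / u) = deriv F z * x * u / (u - x)"
          using x False by (simp add: divide_simps) 
        also have "- (deriv F z / (1 / x)) + \<dots> = - deriv F z / (1 / x)\<^sup>2 / (x - u)"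
          using x \<open>u - x \<noteq> 0\<close> \<open>x - u \<noteq> 0\<close> by (simp add: divide_simps power2_eq_square)
            (simp add: algebra_simps)
        finally show ?thesis using False x(4) by simp
      qed
      have combine: "B / (x - u) + B * R' / R = B * (R + (x - u) * R') / ((x - u) * R)"
        if "R \<noteq> 0" for B R R' :: complex
        using that x(2) by (simp add: field_simps)
      show "- (deriv F z / F z) + (if u = 0 then 0 else deriv F z / (F z - 1 / u))
          + - deriv F z / (F z)\<^sup>2 * poly (pderiv R) (1 / F z) / poly R (1 / F z)
          = - deriv F z / (F z)\<^sup>2 * poly (pderiv P) (1 / F z) / poly P (1 / F z)"
        unfolding x_def[symmetric] P_eval P'_eval by (simp only: factor combine[OF x(3)])
    qed
    moreover have "- (2 * of_real pi * \<i>) + 2 * of_real pi * \<i> * of_nat k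
          + - (2 * of_real pi * \<i> * of_nat m) = - (2 * of_real pi * \<i> * of_nat (1 - k + m))"
      using k by (simp add: of_nat_diff algebra_simps)
    ultimately show ?thesis by metis
  qed
qed

section \<open>The area theorem for polynomials in a reciprocal\<close>

text \<open>
  Parseval's identity on a circle. The power series of \<open>G\<close> is integrated term by term, and
  \<open>cnj z = r\<^sup>2 / z\<close> on the circle turns each term into a Cauchy integral for a coefficient of \<open>S\<close>.
\<close>
lemma sums_integral_cnj_mult_circle:
  fixes G S :: "complex \<Rightarrow> complex"
  assumes G: "G holomorphic_on ball 0 1" and S: "S holomorphic_on ball 0 1" and r: "0 < r" "r < 1"
  defines "\<zeta> \<equiv> circlepath 0 r"
  shows "(\<lambda>k. cnj ((deriv ^^ k) G 0 / fact k) * ((deriv ^^ k) S 0 / fact k) * of_real (r ^ (2 * k)))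
           sums integral {0..1} (\<lambda>t. cnj (G (\<zeta> t)) * S (\<zeta> t))"
proof -
  define g where "g = (\<lambda>k. (deriv ^^ k) G 0 / fact k)"
  define f where "f = (\<lambda>k t. cnj (g k * \<zeta> t ^ k) * S (\<zeta> t))"
  have norm_\<zeta>: "norm (\<zeta> t) = r" for t
    using r by (simp add: \<zeta>_def circlepath norm_mult norm_exp_eq_Re)
  have \<zeta>': "vector_derivative \<zeta> (at t within {0..1}) = 2 * of_real pi * \<i> * \<zeta> t"
    if "0 \<le> t" "t \<le> 1" for t
    unfolding \<zeta>_def vector_derivative_circlepath01[OF that] by (simp add: circlepath)
  have \<zeta>_nz: "\<zeta> t \<noteq> 0" for t using norm_\<zeta>[of t] r by auto
  have \<zeta>_cont: "continuous_on {0..1} \<zeta>"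
    unfolding \<zeta>_def circlepath by (intro continuous_intros)
  have S_cball: "continuous_on (cball 0 r) S"
    by (rule holomorphic_on_imp_continuous_on[OF holomorphic_on_subset[OF S]]) (use r in auto)
  then have S_cont: "continuous_on {0..1} (\<lambda>t. S (\<zeta> t))"
    by (rule continuous_on_compose2[OF _ \<zeta>_cont]) (auto simp: norm_\<zeta>)
  then have "bounded ((\<lambda>t. S (\<zeta> t)) ` {0..1})"
    by (intro compact_imp_bounded compact_continuous_image) auto
  then obtain C where "\<forall>v \<in> (\<lambda>t. S (\<zeta> t)) ` {0..1}. norm v \<le> C" unfolding bounded_iff by blast
  then have C: "norm (S (\<zeta> t)) \<le> C" if "t \<in> {0..1}" for t using that by blast
  have G_sums: "(\<lambda>k. g k * z ^ k) sums G z" if "norm z < 1" for z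
    using holomorphic_power_series[OF G, of z] that by (simp add: g_def)
  have "summable (\<lambda>k. norm (g k) * r ^ k)"
  proof -
    define s where "s = (r + 1) / 2"
    have "summable (\<lambda>k. g k * of_real s ^ k)"
      by (rule sums_summable[OF G_sums]) (use r in \<open>simp add: s_def\<close>)
    then have "summable (\<lambda>k. norm (g k * of_real r ^ k))"
      by (rule powser_insidea) (use r in \<open>simp add: s_def\<close>)
    then show ?thesis using r by (simp add: norm_mult norm_power)
  qed
  then have "summable (\<lambda>k. norm (g k) * r ^ k * C)" by (rule summable_mult2)
  moreover have "norm (f k t) \<le> norm (g k) * r ^ k * C" if "t \<in> {0..1}" for k t
    unfolding f_def norm_mult complex_mod_cnj norm_power norm_\<zeta>
    using r C[OF that] by (intro mult_left_mono) auto
  ultimately have "uniform_limit {0..1} (\<lambda>n t. \<Sum>k<n. f k t) (\<lambda>t. \<Sum>k. f k t) sequentially"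
    by (intro Weierstrass_m_test)
  moreover have "(\<Sum>k. f k t) = cnj (G (\<zeta> t)) * S (\<zeta> t)" for t
    unfolding f_def
    by (intro sums_unique[symmetric] sums_mult2 sums_cnj[THEN iffD2] G_sums) (use r norm_\<zeta> in auto)
  ultimately have "uniform_limit {0..1} (\<lambda>n t. \<Sum>k<n. f k t) (\<lambda>t. cnj (G (\<zeta> t)) * S (\<zeta> t)) sequentially"
    by simp
  moreover have f_cont: "continuous_on {0..1} (f k)" for k
    unfolding f_def by (intro continuous_intros \<zeta>_cont S_cont)
  then have "continuous_on {0..1} (\<lambda>t. \<Sum>k<n. f k t)" for n
    by (intro continuous_intros)
  ultimately obtain I J where IJ: "\<And>n. ((\<lambda>t. \<Sum>k<n. f k t) has_integral I n) {0..1}"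
      "((\<lambda>t. cnj (G (\<zeta> t)) * S (\<zeta> t)) has_integral J) {0..1}" "I \<longlonglongrightarrow> J"
    by (rule uniform_limit_integral) auto
  have I: "I n = (\<Sum>k<n. integral {0..1} (f k))" for n
    using integral_unique[OF IJ(1)[of n]]
    by (simp add: integral_sum integrable_continuous_real f_cont)
  have "integral {0..1} (f k) = cnj (g k) * ((deriv ^^ k) S 0 / fact k) * of_real (r ^ (2 * k))" for k
  proof -
    have "((\<lambda>u. S u / (u - 0) ^ Suc k) has_contour_integral
        2 * of_real pi * \<i> / fact k * (deriv ^^ k) S 0) (circlepath 0 r)"
      using Cauchy_has_contour_integral_higher_derivative_circlepath[of 0 r S 0 k] S_cball r
        holomorphic_on_subset[OF S, of "ball 0 r"] by (simp add: subset_ball)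
    then have "((\<lambda>t. S (\<zeta> t) / \<zeta> t ^ Suc k * (2 * of_real pi * \<i> * \<zeta> t)) has_integral
        2 * of_real pi * \<i> / fact k * (deriv ^^ k) S 0) {0..1}"
      unfolding has_contour_integral_def \<zeta>_def[symmetric]
      by (rule has_integral_eq[rotated]) (auto simp: \<zeta>')
    then have "((\<lambda>t. cnj (g k) * of_real (r ^ (2 * k)) / (2 * of_real pi * \<i>) *
          (S (\<zeta> t) / \<zeta> t ^ Suc k * (2 * of_real pi * \<i> * \<zeta> t))) has_integral
        cnj (g k) * of_real (r ^ (2 * k)) / (2 * of_real pi * \<i>) *
          (2 * of_real pi * \<i> / fact k * (deriv ^^ k) S 0)) {0..1}"
      by (rule has_integral_mult_right)
    moreover have "cnj (g k) * of_real (r ^ (2 * k)) / (2 * of_real pi * \<i>) *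
          (S (\<zeta> t) / \<zeta> t ^ Suc k * (2 * of_real pi * \<i> * \<zeta> t)) = f k t" for t
    proof -
      have "cnj (\<zeta> t) * \<zeta> t = of_real (r ^ 2)"
        using complex_norm_square[of "\<zeta> t"] by (simp add: norm_\<zeta> mult.commute)
      then have "cnj (\<zeta> t) ^ k * \<zeta> t ^ k = of_real (r ^ (2 * k))"
        by (simp add: power_mult_distrib[symmetric] power_mult)
      then have "of_real (r ^ (2 * k)) / \<zeta> t ^ k = cnj (\<zeta> t) ^ k"
        using \<zeta>_nz[of t] by (simp add: field_simps)
      then have "f k t = cnj (g k) * (of_real (r ^ (2 * k)) / \<zeta> t ^ k) * S (\<zeta> t)"
        by (simp add: f_def)
      then show ?thesis using \<zeta>_nz[of t] by (simp add: field_simps)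
    qed
    ultimately have "(f k has_integral cnj (g k) * of_real (r ^ (2 * k)) / (2 * of_real pi * \<i>) *
          (2 * of_real pi * \<i> / fact k * (deriv ^^ k) S 0)) {0..1}"
      by simp
    then have "integral {0..1} (f k) = cnj (g k) * of_real (r ^ (2 * k)) / (2 * of_real pi * \<i>) *
          (2 * of_real pi * \<i> / fact k * (deriv ^^ k) S 0)"
      by (rule integral_unique)
    also have cancel: "a * X / c * (c / b * d) = a * (d / b) * X" if "c \<noteq> 0" for a b c d X :: complex
      using that by simp
    have "cnj (g k) * of_real (r ^ (2 * k)) / (2 * of_real pi * \<i>) * (2 * of_real pi * \<i> / fact k * (deriv ^^ k) S 0)
        = cnj (g k) * ((deriv ^^ k) S 0 / fact k) * of_real (r ^ (2 * k))"
      by (rule cancel) simp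
    finally show ?thesis .
  qed
  then show ?thesis
    using IJ(3) unfolding sums_def I integral_unique[OF IJ(2)] g_def by simp
qed

text \<open>
  The curve \<open>p = P (1 / F)\<close>, traced over the circle of radius \<open>r\<close>, has no positive winding number, so its
  signed area is not positive. Since \<open>p = G / z ^ n\<close> has the Laurent coefficients \<open>g\<^sub>k\<close> at \<open>z ^ (k - n)\<close>,
  this area is \<open>\<pi>\<close> times \<open>\<Sum> (k - n) * \<bar>g\<^sub>k\<bar>\<^sup>2 * r ^ (2 k - 2 n)\<close>. The terms with \<open>k \<ge> n\<close> are
  nonnegative, so the series may be cut off anywhere beyond \<open>n\<close>.
\<close>
theorem area_theorem_polynomial_weighted:
  fixes P :: "complex poly"
  assumes holF: "F holomorphic_on ball 0 1" and inj: "inj_on F (ball 0 1)" and F0: "F 0 = 0"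
    and holG: "G holomorphic_on ball 0 1" and G: "G has_fps_expansion g"
    and eq: "\<And>z. 0 < norm z \<Longrightarrow> norm z < 1 \<Longrightarrow> G z = z ^ n * poly P (1 / F z)"
    and r: "0 < r" "r < 1" and N: "n \<le> N"
  shows "(\<Sum>k\<le>N. (real k - real n) * (norm (fps_nth g k))\<^sup>2 * r ^ (2 * k)) \<le> 0"
proof -
  define \<zeta> where "\<zeta> = (\<lambda>t :: real. of_real r * exp (2 * of_real pi * \<i> * of_real t))"
  have \<zeta>_circ: "circlepath 0 r = \<zeta>" by (simp add: \<zeta>_def circlepath)
  have norm_\<zeta>: "norm (\<zeta> t) = r" for t
    using r by (simp add: \<zeta>_def norm_mult norm_exp_eq_Re)
  have \<zeta>_ball: "\<zeta> t \<in> ball 0 1" for t using norm_\<zeta>[of t] r by simp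
  have \<zeta>_nz: "\<zeta> t \<noteq> 0" for t using norm_\<zeta>[of t] r by auto
  have \<zeta>_deriv: "(\<zeta> has_vector_derivative (2 * of_real pi * \<i> * \<zeta> t)) (at t)" for t
    unfolding \<zeta>_def by (auto intro!: derivative_eq_intros has_vector_derivative_real_field)
  have \<zeta>_cont: "continuous_on UNIV \<zeta>"
    unfolding \<zeta>_def by (intro continuous_intros)
  have F_nz: "F z \<noteq> 0" if "z \<in> ball 0 1" "z \<noteq> 0" for z
    using inj F0 that by (auto simp: inj_on_def)
  have contc: "continuous_on UNIV (\<lambda>t. H (\<zeta> t))" if "H holomorphic_on ball 0 1" for H
    by (rule continuous_on_compose2[OF holomorphic_on_imp_continuous_on[OF that] \<zeta>_cont]) (use \<zeta>_ball in auto)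
  define L where "L = (\<lambda>z. - deriv F z / (F z)\<^sup>2 * poly (pderiv P) (1 / F z))"
  define p where "p = (\<lambda>t. poly P (1 / F (\<zeta> t)))"
  define p' where "p' = (\<lambda>t. L (\<zeta> t) * (2 * of_real pi * \<i> * \<zeta> t))"
  \<comment> \<open>Up to the factor \<open>z ^ n\<close> this is \<open>z\<close> times the derivative of \<open>G / z ^ n\<close>; its coefficients are
    \<open>(k - n) * g\<^sub>k\<close>.\<close>
  define S where "S = (\<lambda>z. z * deriv G z - of_nat n * G z)"
  have holS: "S holomorphic_on ball 0 1"
    unfolding S_def by (intro holomorphic_intros holomorphic_deriv holG) auto
  have deriv_Q: "((\<lambda>z. poly P (1 / F z)) has_field_derivative L z) (at z)" if "z \<in> ball 0 1" "z \<noteq> 0" for z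
  proof -
    have "(F has_field_derivative deriv F z) (at z)"
      by (rule holomorphic_derivI[OF holF]) (use that in auto)
    then have "((\<lambda>z. 1 / F z) has_field_derivative - deriv F z / (F z)\<^sup>2) (at z)"
      using F_nz[OF that] by (auto intro!: derivative_eq_intros simp: power2_eq_square)
    from DERIV_chain2[OF poly_DERIV this] show ?thesis
      by (simp add: L_def mult.commute)
  qed
  have p_deriv: "(p has_vector_derivative p' t) (at t)" for t
    unfolding p_def p'_def mult.commute[of "L (\<zeta> t)"]
    using field_vector_diff_chain_at[OF \<zeta>_deriv deriv_Q[OF \<zeta>_ball \<zeta>_nz]] by (simp add: o_def)
  have "continuous_on UNIV (\<lambda>t. L (\<zeta> t))"
    unfolding L_def using F_nz[OF \<zeta>_ball \<zeta>_nz]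
    by (intro continuous_intros contc holF holomorphic_deriv) auto
  then have p'_cont: "continuous_on UNIV p'"
    unfolding p'_def by (intro continuous_intros \<zeta>_cont)
  have "p 0 = p 1" by (simp add: p_def \<zeta>_def)
  have wind: "Im (integral {0..1} (\<lambda>t. p' t / (p t - w))) \<le> 0" if w: "w \<notin> p ` {0..1}" for w
  proof -
    have nz: "poly (P - [:w:]) (1 / F z) \<noteq> 0" if "norm z = r" for z
    proof -
      have "z \<in> path_image (circlepath 0 r)" using that r by simp
      then obtain t where "t \<in> {0..1}" "z = \<zeta> t"
        unfolding path_image_def \<zeta>_circ by auto
      then show ?thesis using w by (auto simp: p_def)
    qed
    obtain m :: nat where "((\<lambda>z. - deriv F z / (F z)\<^sup>2 * poly (pderiv (P - [:w:])) (1 / F z) / poly (P - [:w:]) (1 / F z))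
         has_contour_integral - (2 * of_real pi * \<i> * of_nat m)) (circlepath 0 r)"
      using has_contour_integral_log_deriv_poly_inverse[OF holF inj F0 r nz] by blast
    then have "((\<lambda>z. L z / (poly P (1 / F z) - w)) has_contour_integral - (2 * of_real pi * \<i> * of_nat m)) \<zeta>"
      by (simp add: L_def pderiv_diff pderiv_pCons \<zeta>_circ)
    then have "((\<lambda>t. p' t / (p t - w)) has_integral - (2 * of_real pi * \<i> * of_nat m)) {0..1}"
      unfolding has_contour_integral_def
    proof (rule has_integral_eq[rotated])
      fix t :: real assume "t \<in> {0..1}"
      then have "vector_derivative \<zeta> (at t within {0..1}) = 2 * of_real pi * \<i> * \<zeta> t"
        by (intro vector_derivative_at_within_ivl[OF \<zeta>_deriv]) auto
      then show "L (\<zeta> t) / (poly P (1 / F (\<zeta> t)) - w) * vector_derivative \<zeta> (at t within {0..1}) = p' t / (p t - w)"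
        by (simp add: p'_def p_def)
    qed
    then show ?thesis by (simp add: integral_unique)
  qed
  have area: "Im (integral {0..1} (\<lambda>t. cnj (p t) * p' t)) \<le> 0"
    by (rule closed_curve_area_nonpos[OF p_deriv p'_cont \<open>p 0 = p 1\<close> wind])
  have p_eq: "cnj (p t) * p' t = 2 * of_real pi * \<i> * of_real (1 / r ^ (2 * n)) * (cnj (G (\<zeta> t)) * S (\<zeta> t))" for t
  proof -
    define z where "z = \<zeta> t"
    have z: "z \<in> ball 0 1" "z \<noteq> 0" "norm z = r"
      using \<zeta>_ball \<zeta>_nz norm_\<zeta> by (auto simp: z_def)
    have Gz: "G z = z ^ n * poly P (1 / F z)" using eq z by simp
    have "((\<lambda>z. z ^ n) has_field_derivative of_nat n * z ^ (n - 1)) (at z)"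
      by (auto intro!: derivative_eq_intros)
    from DERIV_mult[OF this deriv_Q[OF z(1,2)]]
    have "((\<lambda>z. z ^ n * poly P (1 / F z)) has_field_derivative
        of_nat n * z ^ (n - 1) * poly P (1 / F z) + L z * z ^ n) (at z)" .
    then have "(G has_field_derivative of_nat n * z ^ (n - 1) * poly P (1 / F z) + L z * z ^ n) (at z)"
      by (rule has_field_derivative_transform_within_open[where S = "ball 0 1 - {0}"]) (use z eq in auto)
    then have "deriv G z = of_nat n * z ^ (n - 1) * poly P (1 / F z) + L z * z ^ n"
      by (rule DERIV_imp_deriv)
    moreover have "n = 0 \<or> z * z ^ (n - Suc 0) = z ^ n"
      by (cases n) auto
    ultimately have Sz: "S z = z ^ Suc n * L z"
      unfolding S_def Gz by (auto simp: algebra_simps)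
    have "cnj z * z = of_real (r ^ 2)"
      using complex_norm_square[of z] by (simp add: z mult.commute)
    then have zz: "cnj z ^ n * z ^ n = of_real (r ^ (2 * n))"
      by (simp add: power_mult_distrib[symmetric] power_mult)
    have "cnj (G z) * S z = (cnj z ^ n * z ^ n) * (cnj (poly P (1 / F z)) * (L z * z))"
      unfolding Gz Sz by simp
    then show ?thesis
      unfolding p_def p'_def z_def[symmetric] zz using r by simp
  qed
  define c where "c = (\<lambda>k. (real k - real n) * (norm (fps_nth g k))\<^sup>2 * r ^ (2 * k))"
  have S_fps: "S has_fps_expansion (fps_X * fps_deriv g - of_nat n * g)"
    unfolding S_def fps_of_nat[symmetric] by (intro fps_expansion_intros G)
  have "(\<lambda>k. cnj ((deriv ^^ k) G 0 / fact k) * ((deriv ^^ k) S 0 / fact k) * of_real (r ^ (2 * k)))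
           sums integral {0..1} (\<lambda>t. cnj (G (\<zeta> t)) * S (\<zeta> t))"
    using sums_integral_cnj_mult_circle[OF holG holS r] unfolding \<zeta>_circ .
  moreover have "cnj ((deriv ^^ k) G 0 / fact k) * ((deriv ^^ k) S 0 / fact k) * of_real (r ^ (2 * k)) = of_real (c k)" for k
  proof -
    have "fps_nth (fps_X * fps_deriv g - of_nat n * g) k = (of_nat k - of_nat n) * fps_nth g k"
      by (cases k) (simp_all add: fps_of_nat[symmetric] algebra_simps)
    moreover have "cnj (fps_nth g k) * fps_nth g k = of_real ((norm (fps_nth g k))\<^sup>2)"
      by (simp add: complex_norm_square mult.commute del: of_real_power)
    ultimately show ?thesis
      unfolding fps_nth_fps_expansion[OF G, symmetric] fps_nth_fps_expansion[OF S_fps, symmetric] c_def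
      by (simp add: mult_ac)
  qed
  ultimately have "(\<lambda>k. of_real (c k)) sums integral {0..1} (\<lambda>t. cnj (G (\<zeta> t)) * S (\<zeta> t))"
    by simp
  from sums_Re[OF this] have c_sums: "c sums Re (integral {0..1} (\<lambda>t. cnj (G (\<zeta> t)) * S (\<zeta> t)))"
    by simp
  have "integral {0..1} (\<lambda>t. cnj (p t) * p' t)
      = 2 * of_real pi * \<i> * of_real (1 / r ^ (2 * n)) * integral {0..1} (\<lambda>t. cnj (G (\<zeta> t)) * S (\<zeta> t))"
    unfolding p_eq by (rule integral_mult_right)
  then have "Im (integral {0..1} (\<lambda>t. cnj (p t) * p' t))
      = 2 * pi / r ^ (2 * n) * Re (integral {0..1} (\<lambda>t. cnj (G (\<zeta> t)) * S (\<zeta> t)))"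
    by simp
  then have "Re (integral {0..1} (\<lambda>t. cnj (G (\<zeta> t)) * S (\<zeta> t))) \<le> 0"
    using area mult_pos_pos[of "2 * pi / r ^ (2 * n)"] r by (smt (verit) divide_pos_pos pi_gt_zero zero_less_power)
  moreover have "sum c {..N} \<le> suminf c"
    by (rule sum_le_suminf) (use c_sums N r in \<open>auto simp: sums_iff c_def\<close>)
  ultimately show ?thesis using sums_unique[OF c_sums] by (simp add: c_def)
qed

text \<open>
  The limit \<open>r \<rightarrow> 1\<close>. For \<open>P = X\<close> and \<open>n = 1\<close> this is Gronwall's area theorem; when \<open>P\<close> is
  the \<open>n\<close>-th Faber polynomial of \<open>1 / F\<close>, it is the Grunsky inequality for the single index \<open>n\<close>.
\<close>
corollary area_theorem_polynomial:
  fixes P :: "complex poly"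
  assumes "F holomorphic_on ball 0 1" "inj_on F (ball 0 1)" "F 0 = 0"
    and "G holomorphic_on ball 0 1" "G has_fps_expansion g"
    and "\<And>z. 0 < norm z \<Longrightarrow> norm z < 1 \<Longrightarrow> G z = z ^ n * poly P (1 / F z)"
    and "n \<le> N"
  shows "(\<Sum>k\<le>N. (real k - real n) * (norm (fps_nth g k))\<^sup>2) \<le> 0"
proof -
  define h where "h = (\<lambda>r::real. \<Sum>k\<le>N. (real k - real n) * (norm (fps_nth g k))\<^sup>2 * r ^ (2 * k))"
  have "eventually (\<lambda>r::real. h r \<le> 0) (at_left 1)"
    by (rule eventually_at_leftI[of 0])
       (auto simp: h_def intro!: area_theorem_polynomial_weighted[OF assms(1-6) _ _ assms(7)])
  moreover have "isCont h 1" unfolding h_def by (intro continuous_intros)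
  then have "(h \<longlongrightarrow> h 1) (at_left 1)"
    by (meson isCont_def filterlim_at_split)
  ultimately have "h 1 \<le> 0" by (intro tendsto_upperbound) auto
  then show ?thesis by (simp add: h_def)
qed

section \<open>Application to a univalent function and its square root transform\<close>

lemma univalent_divide_by_z:
  assumes holf: "f holomorphic_on ball 0 1" and inj: "inj_on f (ball 0 1)" and f0: "f 0 = 0"
    and fps: "f has_fps_expansion (fps_X * H)" and H0: "fps_nth H 0 = 1"
  obtains h where "h holomorphic_on ball 0 1" "h has_fps_expansion H" "\<And>z. f z = z * h z" "h 0 = 1"
    "\<And>z. z \<in> ball 0 1 \<Longrightarrow> h z \<noteq> 0"
proof -
  define h where "h = (\<lambda>z. if z = 0 then deriv f 0 else (f z - f 0) / (z - 0))"
  have hol: "h holomorphic_on ball 0 1"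
    unfolding h_def by (rule pole_lemma_open) (use holf in auto)
  have eq: "f z = z * h z" for z using f0 by (simp add: h_def)
  have h: "h has_fps_expansion fps_expansion h 0"
    by (rule has_fps_expansion_fps_expansion[OF _ _ hol]) auto
  then have "(\<lambda>z. z * h z) has_fps_expansion (fps_X * fps_expansion h 0)"
    by (intro fps_expansion_intros)
  then have "fps_X * fps_expansion h 0 = fps_X * H"
    using fps unfolding eq[symmetric] by (rule fps_expansion_unique_complex)
  then have hH: "h has_fps_expansion H" using h by simp
  have h0: "h 0 = 1" using has_fps_expansion_imp_0_eq_fps_nth_0[OF hH] H0 by simp
  have "h z \<noteq> 0" if "z \<in> ball 0 1" for z
    using inj f0 that eq[of z] h0 by (cases "z = 0") (auto simp: inj_on_def)
  then show ?thesis using that[OF hol hH eq h0] by blast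
qed

text \<open>
  In terms of the expansion \<open>f = z + a\<^sub>2 z\<^sup>2 + a\<^sub>3 z\<^sup>3 + \<dots>\<close>, where \<open>H\<close> has the coefficients of \<open>f / z\<close>, this is
  \<open>\<bar>a\<^sub>2\<^sup>2 - a\<^sub>3\<bar> \<le> 1\<close>: the number inside is the coefficient of \<open>z\<close> in \<open>1 / f\<close>, and the area
  theorem is applied with \<open>P = X\<close>.
\<close>
lemma norm_a2_squared_minus_a3_le_1:
  assumes holf: "f holomorphic_on ball 0 1" and inj: "inj_on f (ball 0 1)" and f0: "f 0 = 0"
    and fps: "f has_fps_expansion (fps_X * H)" and H0: "fps_nth H 0 = 1"
  shows "norm ((fps_nth H 1)\<^sup>2 - fps_nth H 2) \<le> 1"
proof -
  obtain h where h: "h holomorphic_on ball 0 1" "h has_fps_expansion H" "\<And>z. f z = z * h z"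
    and h0: "h 0 = 1" and h_nz: "\<And>z. z \<in> ball 0 1 \<Longrightarrow> h z \<noteq> 0"
    using univalent_divide_by_z[OF holf inj f0 fps H0] by blast
  have area: "(\<Sum>k\<le>2. (real k - real 1) * (norm (fps_nth (inverse H) k))\<^sup>2) \<le> 0"
  proof (rule area_theorem_polynomial[OF holf inj f0])
    show "(\<lambda>z. inverse (h z)) holomorphic_on ball 0 1"
      using h_nz by (intro holomorphic_intros h) auto
    show "(\<lambda>z. inverse (h z)) has_fps_expansion inverse H"
      using h(2) H0 by (intro fps_expansion_intros) auto
    show "inverse (h z) = z ^ 1 * poly [:0, 1:] (1 / f z)" if "0 < norm z" for z
      using that by (simp add: h(3) field_simps)
  qed auto
  have HH: "inverse H * H = 1" using H0 by (intro inverse_mult_eq_1) auto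
  have g0: "fps_nth (inverse H) 0 = 1" using H0 by simp
  have "fps_nth (inverse H * H) 1 = 0" "fps_nth (inverse H * H) 2 = 0"
    unfolding HH by simp_all
  then have rec: "fps_nth H 1 + fps_nth (inverse H) 1 = 0"
      "fps_nth H 2 + fps_nth (inverse H) 1 * fps_nth H 1 + fps_nth (inverse H) 2 = 0"
    using g0 H0 by (simp_all add: fps_mult_nth numeral_2_eq_2)
  have g1: "fps_nth (inverse H) 1 = - fps_nth H 1"
    using rec(1) by (metis add.commute eq_neg_iff_add_eq_0)
  have "fps_nth (inverse H) 2 = (fps_nth H 1)\<^sup>2 - fps_nth H 2"
  proof -
    have "fps_nth (inverse H) 2 = - (fps_nth H 2 + fps_nth (inverse H) 1 * fps_nth H 1)"
      using rec(2) by (metis add.commute eq_neg_iff_add_eq_0)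
    then show ?thesis unfolding g1 by (simp add: power2_eq_square)
  qed
  then show ?thesis using area g0 by (simp add: atMost_nat_numeral)
qed

text \<open>
  The odd function \<open>F z = sqrt (f (z\<^sup>2))\<close> is again univalent. It is written as \<open>z / \<kappa> (z\<^sup>2)\<close> with
  \<open>\<kappa>\<^sup>2 = z / f z\<close>, because the area theorem needs the coefficients of \<open>1 / F = \<kappa> (z\<^sup>2) / z\<close>.
\<close>
lemma univalent_square_root_transform:
  assumes holf: "f holomorphic_on ball 0 1" and inj: "inj_on f (ball 0 1)" and f0: "f 0 = 0"
    and fps: "f has_fps_expansion (fps_X * H)" and H0: "fps_nth H 0 = 1"
  obtains \<kappa> K where "\<kappa> holomorphic_on ball 0 1" "\<kappa> has_fps_expansion K" "fps_nth K 0 = 1" "K\<^sup>2 * H = 1"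
    "\<And>z. z \<in> ball 0 1 \<Longrightarrow> \<kappa> z \<noteq> 0"
    "(\<lambda>z. z / \<kappa> (z\<^sup>2)) holomorphic_on ball 0 1" "inj_on (\<lambda>z. z / \<kappa> (z\<^sup>2)) (ball 0 1)"
proof -
  obtain h where h: "h holomorphic_on ball 0 1" "h has_fps_expansion H" "\<And>z. f z = z * h z"
    and h0: "h 0 = 1" and h_nz: "\<And>z. z \<in> ball 0 1 \<Longrightarrow> h z \<noteq> 0"
    using univalent_divide_by_z[OF holf inj f0 fps H0] by blast
  have hol_inv: "(\<lambda>z. inverse (h z)) holomorphic_on ball 0 1"
    using h_nz by (intro holomorphic_intros h) auto
  have inv_nz: "inverse (h z) \<noteq> 0" if "z \<in> ball 0 1" for z
    using h_nz[OF that] by simp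
  obtain g where g: "g holomorphic_on ball 0 1" "\<And>z. z \<in> ball 0 1 \<Longrightarrow> inverse (h z) = (g z)\<^sup>2"
    using contractible_imp_holomorphic_sqrt[OF hol_inv convex_imp_contractible[OF convex_ball] inv_nz] by blast
  \<comment> \<open>Since \<open>g 0\<close> is \<open>1\<close> or \<open>-1\<close>, this chooses the branch with \<open>\<kappa> 0 = 1\<close>.\<close>
  define \<kappa> where "\<kappa> = (\<lambda>z. g 0 * g z)"
  have "(g 0)\<^sup>2 = 1" using g(2)[of 0] h0 by simp
  then have \<kappa>0: "\<kappa> 0 = 1" and \<kappa>2: "(\<kappa> z)\<^sup>2 = inverse (h z)" if "z \<in> ball 0 1" for z
    using g(2)[OF that] by (simp_all add: \<kappa>_def power2_eq_square[of "g 0"] power_mult_distrib)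
  have hol\<kappa>: "\<kappa> holomorphic_on ball 0 1"
    unfolding \<kappa>_def by (intro holomorphic_intros g)
  have \<kappa>_nz: "\<kappa> z \<noteq> 0" if "z \<in> ball 0 1" for z
    using \<kappa>2[OF that] h_nz[OF that] by auto
  define K where "K = fps_expansion \<kappa> 0"
  have K: "\<kappa> has_fps_expansion K"
    unfolding K_def by (rule has_fps_expansion_fps_expansion[OF _ _ hol\<kappa>]) auto
  have K0: "fps_nth K 0 = 1"
    using has_fps_expansion_imp_0_eq_fps_nth_0[OF K] \<kappa>0[of 0] by simp
  have "(\<lambda>z. (\<kappa> z)\<^sup>2 * h z) has_fps_expansion K\<^sup>2 * H"
    by (intro fps_expansion_intros K h)
  moreover have "(\<lambda>z. (\<kappa> z)\<^sup>2 * h z) has_fps_expansion 1"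
  proof (subst has_fps_expansion_cong)
    have "eventually (\<lambda>z. z \<in> ball 0 1) (nhds (0::complex))"
      by (intro eventually_nhds_in_open) auto
    then show "eventually (\<lambda>z. (\<kappa> z)\<^sup>2 * h z = 1) (nhds 0)"
      by eventually_elim (use \<kappa>2 h_nz in auto)
  qed auto
  ultimately have KH: "K\<^sup>2 * H = 1" by (rule fps_expansion_unique_complex)
  define F where "F = (\<lambda>z. z / \<kappa> (z\<^sup>2))"
  have sq: "z\<^sup>2 \<in> ball 0 1" if "z \<in> ball 0 1" for z :: complex
    using that by (simp add: norm_power power_less_one_iff)
  have F2: "(F z)\<^sup>2 = f (z\<^sup>2)" if "z \<in> ball 0 1" for z
    using \<kappa>2[OF sq[OF that]] by (simp add: F_def h(3) power_divide field_simps)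
  have holF: "F holomorphic_on ball 0 1"
    unfolding F_def using \<kappa>_nz sq
    by (intro holomorphic_intros holomorphic_on_compose_gen[OF _ hol\<kappa>, unfolded o_def]) auto
  have injF: "inj_on F (ball 0 1)"
  proof (rule inj_onI)
    fix z w assume zw: "z \<in> ball 0 1" "w \<in> ball 0 1" "F z = F w"
    then have "f (z\<^sup>2) = f (w\<^sup>2)" using F2 by metis
    then have *: "z\<^sup>2 = w\<^sup>2" using inj sq zw by (auto simp: inj_on_def)
    then have "z / \<kappa> (z\<^sup>2) = w / \<kappa> (z\<^sup>2)" using zw(3) by (simp add: F_def)
    then show "z = w" using \<kappa>_nz[OF sq[OF zw(1)]] by simp
  qed
  show ?thesis
    using that[OF hol\<kappa> K K0 KH \<kappa>_nz] holF injF unfolding F_def by blast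
qed

text \<open>
  The area theorem for \<open>F z = sqrt (f (z\<^sup>2))\<close> and \<open>P = X ^ 3 + c X\<close>. Here
  \<open>z ^ 3 * P (1 / F z)\<close> is the value of \<open>\<kappa> ^ 3 + c x \<kappa>\<close> at \<open>x = z\<^sup>2\<close>; only even powers of \<open>z\<close>
  occur, which is why the weight \<open>k - 3\<close> at \<open>z ^ k\<close> becomes \<open>2 j - 3\<close>.
\<close>
lemma univalent_odd_cubic_area:
  assumes "f holomorphic_on ball 0 1" "inj_on f (ball 0 1)" "f 0 = 0"
    and "f has_fps_expansion (fps_X * H)" "fps_nth H 0 = 1"
  obtains K where "fps_nth K 0 = 1" "K\<^sup>2 * H = 1"
    "\<And>c. (\<Sum>j\<le>4. (2 * real j - 3) * (norm (fps_nth (K ^ 3 + fps_const c * fps_X * K) j))\<^sup>2) \<le> 0"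
proof -
  obtain \<kappa> K where \<kappa>: "\<kappa> holomorphic_on ball 0 1" "\<kappa> has_fps_expansion K" "\<And>z. z \<in> ball 0 1 \<Longrightarrow> \<kappa> z \<noteq> 0"
    and K: "fps_nth K 0 = 1" "K\<^sup>2 * H = 1"
    and F: "(\<lambda>z. z / \<kappa> (z\<^sup>2)) holomorphic_on ball 0 1" "inj_on (\<lambda>z. z / \<kappa> (z\<^sup>2)) (ball 0 1)"
    using univalent_square_root_transform[OF assms] by blast
  have "(\<Sum>j\<le>4. (2 * real j - 3) * (norm (fps_nth (K ^ 3 + fps_const c * fps_X * K) j))\<^sup>2) \<le> 0" for c
  proof -
    define L where "L = K ^ 3 + fps_const c * fps_X * K"
    define l where "l = (\<lambda>x. \<kappa> x ^ 3 + c * x * \<kappa> x)"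
    have sq: "z\<^sup>2 \<in> ball 0 1" if "z \<in> ball 0 1" for z :: complex
      using that by (simp add: norm_power power_less_one_iff)
    have hol_l: "l holomorphic_on ball 0 1"
      unfolding l_def by (intro holomorphic_intros \<kappa>)
    have "(\<lambda>z::complex. z\<^sup>2) has_fps_expansion fps_X\<^sup>2" by (intro fps_expansion_intros)
    moreover have "l has_fps_expansion L"
      unfolding l_def L_def by (intro fps_expansion_intros \<kappa>)
    ultimately have "(l \<circ> (\<lambda>z. z\<^sup>2)) has_fps_expansion fps_compose L (fps_X\<^sup>2)"
      by (intro has_fps_expansion_compose) auto
    then have exp: "(\<lambda>z. l (z\<^sup>2)) has_fps_expansion fps_compose L (fps_X\<^sup>2)"
      by (simp add: o_def)
    have "(\<Sum>k\<le>8. (real k - real 3) * (norm (fps_nth (fps_compose L (fps_X\<^sup>2)) k))\<^sup>2) \<le> 0"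
    proof (rule area_theorem_polynomial[OF F _ _ exp])
      show "(\<lambda>z. l (z\<^sup>2)) holomorphic_on ball 0 1"
        using sq by (intro holomorphic_on_compose_gen[OF _ hol_l, unfolded o_def] holomorphic_intros) auto
      show "l (z\<^sup>2) = z ^ 3 * poly [:0, c, 0, 1:] (1 / (z / \<kappa> (z\<^sup>2)))" if "0 < norm z" for z
        using that by (simp add: l_def field_simps power2_eq_square power3_eq_cube)
    qed auto
    then show ?thesis
      unfolding L_def[symmetric] by (simp add: fps_nth_compose_X_power atMost_nat_numeral)
  qed
  then show ?thesis using that K by blast
qed

section \<open>Coefficient estimates\<close>

lemma fps_mult_nth_upto_4:
  fixes A B :: "'a :: comm_ring_1 fps"
  shows "fps_nth (A * B) 1 = fps_nth A 0 * fps_nth B 1 + fps_nth A 1 * fps_nth B 0"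
    and "fps_nth (A * B) 2 = fps_nth A 0 * fps_nth B 2 + fps_nth A 1 * fps_nth B 1 + fps_nth A 2 * fps_nth B 0"
    and "fps_nth (A * B) 3 = fps_nth A 0 * fps_nth B 3 + fps_nth A 1 * fps_nth B 2 + fps_nth A 2 * fps_nth B 1
          + fps_nth A 3 * fps_nth B 0"
    and "fps_nth (A * B) 4 = fps_nth A 0 * fps_nth B 4 + fps_nth A 1 * fps_nth B 3 + fps_nth A 2 * fps_nth B 2
          + fps_nth A 3 * fps_nth B 1 + fps_nth A 4 * fps_nth B 0"
  by (simp_all add: fps_mult_nth numeral_eq_Suc)

text \<open>
  For \<open>a\<^sub>3 = 0\<close>, with \<open>\<alpha> = a\<^sub>2\<close>, \<open>d = a\<^sub>4\<close>, \<open>e = a\<^sub>5\<close>. The coefficients of \<open>K\<close> follow one after another from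
  \<open>K\<^sup>2 * H = 1\<close>. The choice \<open>c = 3 \<alpha> / 2\<close> removes the coefficient of \<open>x\<close>, that is, the term \<open>1 / z\<close> of
  \<open>P (1 / F)\<close>, whose weight in the area theorem is negative.
\<close>
lemma odd_cubic_coefficients:
  fixes H K :: "complex fps" and \<alpha> d e :: complex
  assumes K: "fps_nth K 0 = 1" "K\<^sup>2 * H = 1"
    and H: "fps_nth H 0 = 1" "fps_nth H 1 = \<alpha>" "fps_nth H 2 = 0" "fps_nth H 3 = d" "fps_nth H 4 = e"
  defines "L \<equiv> K ^ 3 + fps_const (3 / 2 * \<alpha>) * fps_X * K"
  shows "fps_nth L 0 = 1"
    and "fps_nth L 1 = 0"
    and "fps_nth L 2 = 9 / 8 * \<alpha>\<^sup>2"
    and "fps_nth L 3 = - (3 / 2 * d + 13 / 8 * \<alpha> ^ 3)"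
    and "fps_nth L 4 = - (3 / 2 * e - 3 * \<alpha> * d - 255 / 128 * \<alpha> ^ 4)"
proof -
  define k1 k2 k3 k4 where k: "k1 = fps_nth K 1" "k2 = fps_nth K 2" "k3 = fps_nth K 3" "k4 = fps_nth K 4"
  have q0: "fps_nth (K\<^sup>2) 0 = 1" using K by (simp add: power2_eq_square)
  have q: "fps_nth (K\<^sup>2) 1 = 2 * k1" "fps_nth (K\<^sup>2) 2 = 2 * k2 + k1\<^sup>2"
      "fps_nth (K\<^sup>2) 3 = 2 * k3 + 2 * k1 * k2" "fps_nth (K\<^sup>2) 4 = 2 * k4 + 2 * k1 * k3 + k2\<^sup>2"
    unfolding power2_eq_square fps_mult_nth_upto_4 K k[symmetric] by (simp_all add: algebra_simps)
  have "fps_nth (K\<^sup>2 * H) 1 = 0" "fps_nth (K\<^sup>2 * H) 2 = 0" "fps_nth (K\<^sup>2 * H) 3 = 0" "fps_nth (K\<^sup>2 * H) 4 = 0"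
    unfolding K by simp_all
  then have rec: "\<alpha> + 2 * k1 = 0" "2 * k1 * \<alpha> + (2 * k2 + k1\<^sup>2) = 0"
      "d + (2 * k2 + k1\<^sup>2) * \<alpha> + (2 * k3 + 2 * k1 * k2) = 0"
      "e + 2 * k1 * d + (2 * k3 + 2 * k1 * k2) * \<alpha> + (2 * k4 + 2 * k1 * k3 + k2\<^sup>2) = 0"
    unfolding fps_mult_nth_upto_4 q q0 H by simp_all
  have k1: "k1 = - (1 / 2) * \<alpha>" using rec(1) by algebra
  have k2: "k2 = 3 / 8 * \<alpha>\<^sup>2" using rec(2) unfolding k1 by algebra
  have k3: "k3 = - (1 / 2) * d - 5 / 16 * \<alpha> ^ 3" using rec(3) unfolding k1 k2 by algebra
  have k4: "k4 = - (1 / 2) * e + 3 / 4 * \<alpha> * d + 35 / 128 * \<alpha> ^ 4"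
    using rec(4) unfolding k1 k2 k3 by algebra
  have L: "L = K\<^sup>2 * K + fps_const (3 / 2 * \<alpha>) * (fps_X * K)"
    by (simp add: L_def power2_eq_square power3_eq_cube mult.assoc)
  show "fps_nth L 0 = 1" unfolding L using q0 K by simp
  have X: "fps_nth (fps_X * K) 1 = 1" "fps_nth (fps_X * K) 2 = k1" "fps_nth (fps_X * K) 3 = k2" "fps_nth (fps_X * K) 4 = k3"
    using K by (simp_all add: k)
  note simps = fps_add_nth fps_mult_left_const_nth X fps_mult_nth_upto_4[of "K\<^sup>2" K] q q0 K(1) k[symmetric]
  show "fps_nth L 1 = 0" unfolding L simps k1 by algebra
  show "fps_nth L 2 = 9 / 8 * \<alpha>\<^sup>2" unfolding L simps k1 k2 by algebra
  show "fps_nth L 3 = - (3 / 2 * d + 13 / 8 * \<alpha> ^ 3)" unfolding L simps k1 k2 k3 by algebra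
  show "fps_nth L 4 = - (3 / 2 * e - 3 * \<alpha> * d - 255 / 128 * \<alpha> ^ 4)" unfolding L simps k1 k2 k3 k4 by algebra
qed

text \<open>
  Equality holds for \<open>s = 1\<close>, \<open>x = sqrt 37 / 8\<close>. With \<open>x\<close> at its largest the left-hand side increases
  with \<open>s\<close>: what the term in \<open>x\<close> loses is of order \<open>1 - s ^ 4\<close> with a small factor and is outweighed
  by the gain in \<open>s ^ 3\<close>, since \<open>1 - s ^ 4 \<le> 2 * (1 - s ^ 3)\<close>.
\<close>
lemma fourth_coefficient_extremal_bound:
  fixes s x :: real
  assumes s: "0 \<le> s" "s \<le> 1" and x: "x\<^sup>2 \<le> 1 - 27 / 64 * s ^ 4"
  shows "2 / 3 * x + 13 / 12 * s ^ 3 \<le> (sqrt 37 + 13) / 12"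
proof -
  define y where "y = sqrt 37 / 8 + 13 / 8 * (1 - s ^ 3)"
  have s3: "s ^ 3 \<le> 1" using s by (simp add: power_le_one)
  have sqrt: "6 \<le> sqrt 37" by (rule real_le_rsqrt) simp
  have "s ^ 3 * (1 - s) \<le> 1 * (1 - s)" using s s3 by (intro mult_right_mono) auto
  moreover have "s ^ 3 \<le> s" using s power_decreasing[of 1 3 s] by simp
  moreover have "s ^ 4 = s ^ 3 * s" by (simp add: eval_nat_numeral)
  ultimately have s4: "1 - s ^ 4 \<le> 2 * (1 - s ^ 3)" by (simp add: algebra_simps)
  have "27 / 64 * (1 - s ^ 4) \<le> 27 / 64 * (2 * (1 - s ^ 3))"
    using s4 by (rule mult_left_mono) simp
  also have "\<dots> = 27 / 32 * (1 - s ^ 3)" by simp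
  also have "\<dots> \<le> 39 / 16 * (1 - s ^ 3)"
    using s3 by (intro mult_right_mono) auto
  finally have "37 / 64 + 27 / 64 * (1 - s ^ 4) \<le> 37 / 64 + 39 / 16 * (1 - s ^ 3)"
    by (rule add_left_mono)
  also have "\<dots> \<le> 37 / 64 + 2 * (sqrt 37 / 8) * (13 / 8) * (1 - s ^ 3)"
    using sqrt s3 by (intro add_left_mono mult_right_mono) auto
  also have "\<dots> \<le> 37 / 64 + 2 * (sqrt 37 / 8) * (13 / 8) * (1 - s ^ 3) + (13 / 8 * (1 - s ^ 3))\<^sup>2"
    by simp
  also have "\<dots> = y\<^sup>2"
    by (simp add: y_def power2_sum power_divide)
  finally have "x\<^sup>2 \<le> y\<^sup>2" using x by (simp add: right_diff_distrib)
  moreover have "0 \<le> y" using sqrt s3 by (simp add: y_def)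
  ultimately have "x \<le> y" by (rule power2_le_imp_le)
  then show ?thesis by (simp add: y_def field_simps)
qed

text \<open>
  \<open>D\<close> and \<open>E\<close> are the quantities that the area inequality controls, so \<open>d\<close>, \<open>e\<close> and the third Hankel
  determinant \<open>- (d\<^sup>2 + e * \<alpha>\<^sup>2)\<close> are rewritten as polynomials in \<open>\<alpha>\<close>, \<open>D\<close> and \<open>E\<close>. The bound for \<open>d\<close> needs
  the trade-off between \<open>\<bar>D\<bar>\<close> and \<open>\<bar>\<alpha>\<bar>\<close>. For \<open>e\<close> and for the determinant,
  \<open>\<bar>D\<bar> \<le> 1\<close>, \<open>\<bar>E\<bar>\<^sup>2 \<le> 3 / 5\<close> and the triangle inequality give round constants below
  the ones required.
\<close>
lemma coefficient_bounds_from_area: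
  fixes \<alpha> d e :: complex
  defines "D \<equiv> 3 / 2 * d + 13 / 8 * \<alpha> ^ 3" and "E \<equiv> 3 / 2 * e - 3 * \<alpha> * d - 255 / 128 * \<alpha> ^ 4"
  assumes \<alpha>: "norm \<alpha> \<le> 1"
    and area: "(norm (9 / 8 * \<alpha>\<^sup>2))\<^sup>2 + 3 * (norm D)\<^sup>2 + 5 * (norm E)\<^sup>2 \<le> 3"
  shows "norm d \<le> (sqrt 37 + 13) / 12"
    and "norm e \<le> 27 / 10"
    and "norm (d\<^sup>2 + e * \<alpha>\<^sup>2) \<le> 71 / 50"
proof -
  have d: "d = 2 / 3 * D - 13 / 12 * \<alpha> ^ 3"
    unfolding D_def by algebra
  have e: "e = 2 / 3 * E + 4 / 3 * \<alpha> * D - 161 / 192 * \<alpha> ^ 4"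
    unfolding D_def E_def by algebra
  have pow: "norm \<alpha> ^ k \<le> 1" for k using \<alpha> by (simp add: power_le_one)
  have "(norm (9 / 8 * \<alpha>\<^sup>2))\<^sup>2 = 81 / 64 * norm \<alpha> ^ 4"
    by (simp add: norm_mult norm_power power_mult_distrib power_divide flip: power_mult)
  with area have sq: "81 / 64 * norm \<alpha> ^ 4 + 3 * (norm D)\<^sup>2 + 5 * (norm E)\<^sup>2 \<le> 3" by simp
  have sq_nonneg: "0 \<le> (norm D)\<^sup>2" "0 \<le> (norm E)\<^sup>2" "0 \<le> norm \<alpha> ^ 4" by auto
  have "(norm D)\<^sup>2 \<le> 1 - 27 / 64 * norm \<alpha> ^ 4" using sq sq_nonneg by linarith
  from fourth_coefficient_extremal_bound[OF norm_ge_zero \<alpha> this]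
  show "norm d \<le> (sqrt 37 + 13) / 12"
    unfolding d using norm_triangle_ineq4[of "2 / 3 * D" "13 / 12 * \<alpha> ^ 3"]
    by (simp add: norm_mult norm_power)
  have D2: "(norm D)\<^sup>2 \<le> 1\<^sup>2" unfolding power_one using sq sq_nonneg by linarith
  have "(norm E)\<^sup>2 \<le> 3 / 5" using sq sq_nonneg by linarith
  \<comment> \<open>A rational number slightly above \<open>sqrt (3 / 5)\<close>.\<close>
  also have "\<dots> \<le> (78 / 100)\<^sup>2" by (simp add: power2_eq_square)
  finally have "(norm E)\<^sup>2 \<le> (78 / 100)\<^sup>2" .
  with D2 have D1: "norm D \<le> 1" and E1: "norm E \<le> 78 / 100"
    by (auto intro: power2_le_imp_le)
  have "norm \<alpha> ^ k * norm D \<le> 1" for k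
    using mult_mono[OF pow[of k] D1] by simp
  moreover have "norm \<alpha> ^ k * norm E \<le> 78 / 100" for k
    using mult_mono[OF pow[of k] E1] by simp
  ultimately have bounds: "norm \<alpha> * norm D \<le> 1" "norm \<alpha> ^ 3 * norm D \<le> 1" "(norm \<alpha>)\<^sup>2 * norm E \<le> 78 / 100"
    by (metis power_one_right)+
  note bounds = bounds pow[of 4] pow[of 6] D1 E1
  show "norm e \<le> 27 / 10"
  proof -
    have "norm e \<le> norm (2 / 3 * E) + norm (4 / 3 * \<alpha> * D) + norm (161 / 192 * \<alpha> ^ 4)"
      unfolding e using norm_triangle_ineq4[of "2 / 3 * E + 4 / 3 * \<alpha> * D" "161 / 192 * \<alpha> ^ 4"]
        norm_triangle_ineq[of "2 / 3 * E" "4 / 3 * \<alpha> * D"] by linarith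
    also have "\<dots> = 2 / 3 * norm E + 4 / 3 * (norm \<alpha> * norm D) + 161 / 192 * norm \<alpha> ^ 4"
      by (simp add: norm_mult norm_power)
    also have "\<dots> \<le> 27 / 10" using bounds by simp
    finally show ?thesis .
  qed
  have "(norm D)\<^sup>2 \<le> 1" using \<open>(norm D)\<^sup>2 \<le> 1\<^sup>2\<close> by simp
  have H3: "d\<^sup>2 + e * \<alpha>\<^sup>2 = 4 / 9 * D\<^sup>2 - 1 / 9 * \<alpha> ^ 3 * D + (193 / 576 * \<alpha> ^ 6 + 2 / 3 * \<alpha>\<^sup>2 * E)"
    unfolding d e by algebra
  have "norm (d\<^sup>2 + e * \<alpha>\<^sup>2) \<le> norm (4 / 9 * D\<^sup>2) + norm (1 / 9 * \<alpha> ^ 3 * D) + (norm (193 / 576 * \<alpha> ^ 6) + norm (2 / 3 * \<alpha>\<^sup>2 * E))"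
    unfolding H3 by (rule norm_triangle_le[OF add_mono[OF norm_triangle_ineq4 norm_triangle_ineq]])
  also have "\<dots> = 4 / 9 * (norm D)\<^sup>2 + 1 / 9 * (norm \<alpha> ^ 3 * norm D) + (193 / 576 * norm \<alpha> ^ 6 + 2 / 3 * (norm \<alpha> ^ 2 * norm E))"
    by (simp add: norm_mult norm_power)
  also have "\<dots> \<le> 71 / 50"
    using bounds \<open>(norm D)\<^sup>2 \<le> 1\<close> by simp
  finally show "norm (d\<^sup>2 + e * \<alpha>\<^sup>2) \<le> 71 / 50" .
qed

lemma coefficient_fps_expansion:
  fixes f :: "complex \<Rightarrow> complex" and a :: "nat \<Rightarrow> complex"
  assumes "\<And>z. norm z < 1 \<Longrightarrow> (\<lambda>n. a (n + 2) * z ^ (n + 2)) sums (f z - z)"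
  shows "f has_fps_expansion fps_X * Abs_fps (\<lambda>n. if n = 0 then 1 else a (n + 1))"
proof (rule has_fps_expansionI)
  define A where "A = fps_X * Abs_fps (\<lambda>n. if n = 0 then 1 else a (n + 1))"
  have A: "fps_nth A 0 = 0" "fps_nth A 1 = 1" "fps_nth A (n + 2) = a (n + 2)" for n
    by (simp_all add: A_def)
  have sums: "(\<lambda>n. fps_nth A n * z ^ n) sums f z" if "z \<in> ball 0 1" for z
  proof -
    have "(\<lambda>n. fps_nth A (n + 2) * z ^ (n + 2)) sums (f z - z)"
      using assms[of z] that unfolding A by simp
    then show ?thesis
      using A by (subst (asm) sums_iff_shift) (simp add: numeral_2_eq_2)
  qed
  have "eventually (\<lambda>z. z \<in> ball 0 1) (nhds (0::complex))"
    by (intro eventually_nhds_in_open) auto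
  then show "eventually (\<lambda>z. (\<lambda>n. fps_nth (fps_X * Abs_fps (\<lambda>n. if n = 0 then 1 else a (n + 1))) n * z ^ n) sums f z) (nhds 0)"
    by eventually_elim (use sums in \<open>simp add: A_def\<close>)
qed

theorem theorem2:
  fixes f :: "complex \<Rightarrow> complex" and a :: "nat \<Rightarrow> complex"
  assumes "f \<in> class_S"
    and "\<And>z. norm z < 1 \<Longrightarrow> (\<lambda>n. a (n + 2) * z ^ (n + 2)) sums (f z - z)"
    and "a 3 = 0"
  shows "norm (a 2) \<le> 1
    \<and> (norm (a 4) \<le> (sqrt 37 + 13) / 12
        \<and> (sqrt 37 + 13) / 12 \<in> {1.59023..<1.59024::real})
    \<and> (norm (a 5) \<le> 1 / 4 * sqrt (757 / 15) + 85 / 64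
        \<and> 1 / 4 * sqrt (757 / 15) + 85 / 64 \<in> {3.10412..<3.10413::real})
    \<and> (norm (hankel_2_2 a) \<le> (13 + sqrt 37) / 12
        \<and> (13 + sqrt 37) / 12 \<in> {1.59023..<1.59024::real})
    \<and> (norm (hankel_3_1 a) \<le> (24 + sqrt 645) / 30
        \<and> (24 + sqrt 645) / 30 \<in> {1.64656..<1.64657::real})"
proof -
  define H where "H = Abs_fps (\<lambda>n. if n = 0 then 1 else a (n + 1))"
  have H: "fps_nth H 0 = 1" "fps_nth H 1 = a 2" "fps_nth H 2 = 0" "fps_nth H 3 = a 4" "fps_nth H 4 = a 5"
    using assms(3) by (simp_all add: H_def numeral_eq_Suc)
  have f: "f holomorphic_on ball 0 1" "inj_on f (ball 0 1)" "f 0 = 0"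
    using assms(1) by (auto simp: class_S_def analytic_imp_holomorphic)
  have exp: "f has_fps_expansion fps_X * H"
    unfolding H_def by (rule coefficient_fps_expansion[OF assms(2)])
  have "norm ((a 2)\<^sup>2) \<le> 1"
    using norm_a2_squared_minus_a3_le_1[OF f exp H(1)] unfolding H by simp
  then have a2: "norm (a 2) \<le> 1"
    using power2_le_imp_le[of "norm (a 2)" 1] by (simp add: norm_power)
  obtain K where K: "fps_nth K 0 = 1" "K\<^sup>2 * H = 1"
    and area: "\<And>c. (\<Sum>j\<le>4. (2 * real j - 3) * (norm (fps_nth (K ^ 3 + fps_const c * fps_X * K) j))\<^sup>2) \<le> 0"
    using univalent_odd_cubic_area[OF f exp H(1)] by blast
  define L where "L = K ^ 3 + fps_const (3 / 2 * a 2) * fps_X * K"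
  have "- 3 * (norm (fps_nth L 0))\<^sup>2 - (norm (fps_nth L 1))\<^sup>2 + (norm (fps_nth L 2))\<^sup>2
      + 3 * (norm (fps_nth L 3))\<^sup>2 + 5 * (norm (fps_nth L 4))\<^sup>2 \<le> 0"
    using area[of "3 / 2 * a 2", folded L_def] by (simp add: atMost_nat_numeral)
  then have "(norm (9 / 8 * (a 2)\<^sup>2))\<^sup>2 + 3 * (norm (3 / 2 * a 4 + 13 / 8 * a 2 ^ 3))\<^sup>2
      + 5 * (norm (3 / 2 * a 5 - 3 * a 2 * a 4 - 255 / 128 * a 2 ^ 4))\<^sup>2 \<le> 3"
    unfolding odd_cubic_coefficients[OF K H, folded L_def] norm_minus_cancel by simp
  note bounds = coefficient_bounds_from_area[OF a2 this]
  have s37: "6.08276 \<le> sqrt 37" "sqrt 37 < 6.08288"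
    by (rule real_le_rsqrt real_less_lsqrt; simp add: power2_eq_square)+
  have s757: "7.10398 \<le> sqrt (757 / 15)" "sqrt (757 / 15) < 7.10402"
    by (rule real_le_rsqrt real_less_lsqrt; simp add: power2_eq_square)+
  have s645: "25.3968 \<le> sqrt 645" "sqrt 645 < 25.3971"
    by (rule real_le_rsqrt real_less_lsqrt; simp add: power2_eq_square)+
  have "norm (a 2 * a 4) \<le> 1 * norm (a 4)"
    unfolding norm_mult using a2 by (intro mult_right_mono) auto
  then have H2: "norm (hankel_2_2 a) \<le> (13 + sqrt 37) / 12"
    using bounds(1) assms(3) by (simp add: hankel_2_2_def add.commute)
  have "hankel_3_1 a = - ((a 4)\<^sup>2 + a 5 * (a 2)\<^sup>2)"
    using assms(3) by (simp add: hankel_3_1_def power2_eq_square)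
  then have H3: "norm (hankel_3_1 a) \<le> 71 / 50"
    using bounds(3) by (simp only: norm_minus_cancel)
  show ?thesis
    using a2 bounds(1,2) H2 H3 s37 s757 s645 by simp
qed

end
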